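(* Let $\Gamma=(\mathsf{V},\mathsf{E})$ be a finite simplicial graph, and let $\theta\colon\mathfrak{sl}_2\to\mathfrak{gl}(V)$ be a finite-dimensional representation with $V\neq0$. Then, with $\mathfrak{g}=\mathfrak{sl}_2$, the following are decompositions into irreducible components: $$\mathcal{F}(A^\bullet_\Gamma,\mathfrak{sl}_2)=\bigcup_{\mathsf{W}\ \preccurlyeq\text{-maximal}}S_{\mathsf{W}},$$ $$\mathcal{R}^1_1(A^\bullet_\Gamma,\theta)=\bigcup_{\substack{c(\mathsf{W})=1\\ \mathsf{W}\ \preccurlyeq\text{-maximal}}}P_{\mathsf{W}}\ \cup\bigcup_{\substack{c(\mathsf{W})>1\\ \nexists\,\mathsf{W}'\ne\mathsf{W}\text{ with }\mathsf{W}\preccurlyeq\mathsf{W}'\text{ and }c(\mathsf{W}')>1}}S_{\mathsf{W}},$$ where $\mathsf{W}$ and $\mathsf{W}'$ denote subsets of $\mathsf{V}$, and $\preccurlyeq$-maximal means maximal among all subsets of $\mathsf{V}$ with respect to the order $\preccurlyeq$.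
   Context: Everything is over $\mathbb{C}$. For a finite simplicial graph $\Gamma=(\mathsf{V},\mathsf{E})$, $A^\bullet_\Gamma=H^\bullet(\pi_\Gamma,\mathbb{C})$ is the cohomology algebra of the right-angled Artin group $\pi_\Gamma$ (generators $v\in\mathsf{V}$, relations $vw=wv$ for $\{v,w\}\in\mathsf{E}$), endowed with zero differential. It is the quotient of the exterior algebra on degree $1$ generators $v^*$, $v\in\mathsf{V}$, by the ideal generated by the monomials $v^*w^*$ with $\{v,w\}\notin\mathsf{E}$; thus $A^1_\Gamma=\mathbb{C}^{\mathsf{V}}$. For a commutative differential graded algebra $A$, $A\otimes\mathfrak{g}$ has bracket $[\alpha\otimes x,\beta\otimes y]=\alpha\beta\otimes[x,y]$ and differential $\partial(\alpha\otimes x)=d\alpha\otimes x$; $\mathcal{F}(A,\mathfrak{g})=\{\omega\in A^1\otimes\mathfrak{g}\mid\partial\omega+\frac12[\omega,\omega]=0\}$. For $\omega=\sum_i\eta_i\otimes g_i\in\mathcal{F}(A,\mathfrak{g})$, put $d_\omega(\alpha\otimes v)=d\alpha\otimes v+\sum_i\eta_i\alpha\otimes\theta(g_i)v$ on $A\otimes V$, and $\mathcal{R}^1_1(A,\theta)=\{\omega\in\mathcal{F}(A,\mathfrak{g})\mid H^1(A\otimes V,d_\omega)\ne0\}$. Elements $\omega\in\mathbb{C}^{\mathsf{V}}\otimes\mathfrak{g}$ are written as tuples $(\omega_v)_{v\in\mathsf{V}}$, $\omega_v\in\mathfrak{g}$. For $\mathsf{W}\subseteq\mathsf{V}$, let $\Gamma_{\mathsf{W}}$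 be the induced subgraph, $c=c(\mathsf{W})$ its number of connected components, $\mathsf{W}_1,\dots,\mathsf{W}_c$ their vertex sets, $\overline{\mathsf{W}}=\mathsf{V}\setminus\mathsf{W}$. Put $$S_{\mathsf{W}}=\{\omega\in\mathbb{C}^{\mathsf{V}}\otimes\mathfrak{g}\mid\omega_v=0\text{ for }v\in\overline{\mathsf{W}},\ \operatorname{rank}\{\omega_v\}_{v\in\mathsf{W}_i}\le1\text{ for }1\le i\le c\}$$ (rank = dimension of the linear span), and let $P_{\mathsf{W}}$ be the set of $\omega\in\mathbb{C}^{\mathsf{V}}\otimes\mathfrak{g}$ with $\omega_v=0$ for $v\in\overline{\mathsf{W}}$ and $\omega_v=\lambda_vg_{\mathsf{W}}$ for $v\in\mathsf{W}$, where $\lambda_v\in\mathbb{C}$ and $g_{\mathsf{W}}\in V(\det\circ\theta)=\{g\in\mathfrak{g}\mid\det(\theta(g))=0\}$ is independent of $v$. Order: for $\mathsf{W}\subseteq\mathsf{W}'$ let $K_{\mathsf{W}\mathsf{W}'}\colon\{\mathsf{W}_1,\dots,\mathsf{W}_c\}\to\{\mathsf{W}'_1,\dots,\mathsf{W}'_{c'}\}$ be the induced map from the connected components of $\Gamma_{\mathsf{W}}$ to those of $\Gamma_{\mathsf{W}'}$. Define $\mathsf{W}\preccurlyeq\mathsf{W}'$ if and only if $\mathsf{W}\subseteq\mathsf{W}'$ and $K_{\mathsf{W}\mathsf{W}'}$ is injective. *)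

theory Defs
  imports "HOL-Analysis.Analysis" "HOL-Library.Function_Algebras"
begin

definition simplicial_graph :: "'v set \<Rightarrow> 'v set set \<Rightarrow> bool" where
  "simplicial_graph V E \<longleftrightarrow> finite V \<and> (\<forall>e\<in>E. e \<subseteq> V \<and> card e = 2)"

definition components_of_induced :: "'v set set \<Rightarrow> 'v set \<Rightarrow> 'v set set" where
  "components_of_induced E W =
     W // {(u, v). u \<in> W \<and> v \<in> W \<and> (u, v) \<in> {(x, y). x \<in> W \<and> y \<in> W \<and> {x, y} \<in> E}\<^sup>*}"

definition num_components :: "'v set set \<Rightarrow> 'v set \<Rightarrow> nat" where
  "num_components E W = card (components_of_induced E W)"

definition component_map :: "'v set set \<Rightarrow> 'v set \<Rightarrow> 'v set \<Rightarrow> 'v set \<Rightarrow> 'v set" where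
  "component_map E W W' C = (THE C'. C' \<in> components_of_induced E W' \<and> C \<subseteq> C')"

definition sub_preceq :: "'v set set \<Rightarrow> 'v set \<Rightarrow> 'v set \<Rightarrow> bool" where
  "sub_preceq E W W' \<longleftrightarrow>
     W \<subseteq> W' \<and> inj_on (component_map E W W') (components_of_induced E W)"

definition preceq_maximal :: "'v set \<Rightarrow> 'v set set \<Rightarrow> 'v set \<Rightarrow> bool" where
  "preceq_maximal V E W \<longleftrightarrow> W \<subseteq> V \<and> (\<forall>W'. W' \<subseteq> V \<and> sub_preceq E W W' \<longrightarrow> W' = W)"


definition mat_scale :: "complex \<Rightarrow> complex^'n^'m \<Rightarrow> complex^'n^'m" where
  "mat_scale c A = (\<chi> i j. c * A $ i $ j)"

definition lie_bracket :: "complex^'n^'n \<Rightarrow> complex^'n^'n \<Rightarrow> complex^'n^'n" where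
  "lie_bracket A B = A ** B - B ** A"

definition sl2 :: "(complex^2^2) set" where
  "sl2 = {A. trace A = 0}"

text \<open>The nonzero finite-dimensional representation space is \<open>complex^'n\<close>, of arbitrary
  dimension \<open>CARD('n)\<close>, which is positive. Only the values of \<open>\<theta>\<close> on \<open>sl2\<close> matter.\<close>

definition sl2_representation :: "(complex^2^2 \<Rightarrow> complex^'n^'n) \<Rightarrow> bool" where
  "sl2_representation \<theta> \<longleftrightarrow>
     (\<forall>x\<in>sl2. \<forall>y\<in>sl2. \<theta> (x + y) = \<theta> x + \<theta> y) \<and>
     (\<forall>c. \<forall>x\<in>sl2. \<theta> (mat_scale c x) = mat_scale c (\<theta> x)) \<and>
     (\<forall>x\<in>sl2. \<forall>y\<in>sl2. \<theta> (lie_bracket x y) = lie_bracket (\<theta> x) (\<theta> y))"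


text \<open>Write \<open>T\<close> for the free associative (tensor) algebra on \<open>V\<close>; words over \<open>V\<close> form a basis.
  For a vector space \<open>M\<close>, an element of \<open>T \<otimes> M\<close> is a finitely supported function from words
  to \<open>M\<close>, the function \<open>\<alpha>\<close> standing for the sum of the tensors \<open>w \<otimes> \<alpha> w\<close>. Thus \<open>T\<close> itself
  is the case \<open>M = \<complex>\<close>.\<close>

definition tensor_alg :: "'v set \<Rightarrow> 'm::zero set \<Rightarrow> ('v list \<Rightarrow> 'm) set" where
  "tensor_alg V M =
     {\<alpha>. finite {w. \<alpha> w \<noteq> 0} \<and> (\<forall>w. \<alpha> w \<in> M) \<and> (\<forall>w. \<alpha> w \<noteq> 0 \<longrightarrow> w \<in> lists V)}"

definition tensor_alg_deg :: "nat \<Rightarrow> 'v set \<Rightarrow> 'm::zero set \<Rightarrow> ('v list \<Rightarrow> 'm) set" where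
  "tensor_alg_deg k V M = {\<alpha> \<in> tensor_alg V M. \<forall>w. \<alpha> w \<noteq> 0 \<longrightarrow> length w = k}"

text \<open>For a bilinear map \<open>b : L \<times> M \<rightarrow> N\<close>, the map \<open>conv b\<close> is the bilinear extension
  \<open>(T \<otimes> L) \<times> (T \<otimes> M) \<rightarrow> T \<otimes> N\<close> of \<open>(s \<otimes> x, t \<otimes> y) \<mapsto> st \<otimes> b x y\<close>: the sum below runs over
  all factorizations \<open>w = st\<close>. With \<open>b\<close> the product of \<open>\<complex>\<close> it is the product of \<open>T\<close>.\<close>

definition conv :: "('l \<Rightarrow> 'm \<Rightarrow> 'n::comm_monoid_add) \<Rightarrow> ('v list \<Rightarrow> 'l) \<Rightarrow> ('v list \<Rightarrow> 'm)
    \<Rightarrow> 'v list \<Rightarrow> 'n" where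
  "conv b \<alpha> \<beta> w = (\<Sum>k\<le>length w. b (\<alpha> (take k w)) (\<beta> (drop k w)))"

definition word :: "'v list \<Rightarrow> 'v list \<Rightarrow> complex" where
  "word u = (\<lambda>w. if w = u then 1 else 0)"

text \<open>The exterior algebra is the quotient of \<open>T\<close> by the squares of the degree 1 elements;
  dividing further by the monomials of the non-edges gives \<open>A\<^sub>\<Gamma>\<close>, so \<open>A\<^sub>\<Gamma> = T / I\<close> with \<open>I\<close> the
  two-sided ideal generated by both kinds of relators.\<close>

definition raag_relators :: "'v set \<Rightarrow> 'v set set \<Rightarrow> ('v list \<Rightarrow> complex) set" where
  "raag_relators V E =
     {conv (*) x x | x. x \<in> tensor_alg_deg 1 V UNIV} \<union>
     {word [v, w] | v w. v \<in> V \<and> w \<in> V \<and> {v, w} \<notin> E}"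

inductive_set raag_ideal :: "'v set \<Rightarrow> 'v set set \<Rightarrow> ('v list \<Rightarrow> complex) set"
  for V :: "'v set" and E :: "'v set set" where
  zero: "0 \<in> raag_ideal V E"
| add: "\<alpha> \<in> raag_ideal V E \<Longrightarrow> \<beta> \<in> raag_ideal V E \<Longrightarrow> \<alpha> + \<beta> \<in> raag_ideal V E"
| gen: "r \<in> raag_relators V E \<Longrightarrow> p \<in> tensor_alg V UNIV \<Longrightarrow> q \<in> tensor_alg V UNIV \<Longrightarrow>
    conv (*) (conv (*) p r) q \<in> raag_ideal V E"

text \<open>\<open>I \<otimes> M\<close> inside \<open>T \<otimes> M\<close>, where \<open>sc\<close> is the scalar multiplication of \<open>M\<close>.\<close>

inductive_set ideal_tensor :: "(complex \<Rightarrow> 'm \<Rightarrow> 'm::comm_monoid_add) \<Rightarrow> 'm set \<Rightarrow>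
    'v set \<Rightarrow> 'v set set \<Rightarrow> ('v list \<Rightarrow> 'm) set"
  for sc :: "complex \<Rightarrow> 'm \<Rightarrow> 'm::comm_monoid_add" and M :: "'m set"
    and V :: "'v set" and E :: "'v set set" where
  zero: "0 \<in> ideal_tensor sc M V E"
| add: "\<alpha> \<in> ideal_tensor sc M V E \<Longrightarrow> \<beta> \<in> ideal_tensor sc M V E \<Longrightarrow>
    \<alpha> + \<beta> \<in> ideal_tensor sc M V E"
| pure: "i \<in> raag_ideal V E \<Longrightarrow> m \<in> M \<Longrightarrow> (\<lambda>w. sc (i w) m) \<in> ideal_tensor sc M V E"

text \<open>The class of \<open>\<alpha> \<in> T \<otimes> M\<close> in \<open>A\<^sub>\<Gamma> \<otimes> M = (T \<otimes> M) / (I \<otimes> M)\<close>.\<close>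

definition raag_class :: "(complex \<Rightarrow> 'm \<Rightarrow> 'm::ab_group_add) \<Rightarrow> 'm set \<Rightarrow>
    'v set \<Rightarrow> 'v set set \<Rightarrow> ('v list \<Rightarrow> 'm) \<Rightarrow> ('v list \<Rightarrow> 'm) set" where
  "raag_class sc M V E \<alpha> = {\<beta> \<in> tensor_alg V M. \<beta> - \<alpha> \<in> ideal_tensor sc M V E}"

text \<open>\<open>A\<^sub>\<Gamma>\<close> carries the zero differential, and so does \<open>A\<^sub>\<Gamma> \<otimes> M\<close>; both are written with
  representatives in \<open>T \<otimes> M\<close>.\<close>

definition raag_diff :: "('v list \<Rightarrow> 'm::zero) \<Rightarrow> 'v list \<Rightarrow> 'm" where
  "raag_diff \<alpha> = (\<lambda>w. 0)"


text \<open>\<open>\<complex>\<^sup>V \<otimes> sl2\<close> as tuples indexed by \<open>V\<close>, extended by \<open>0\<close> outside \<open>V\<close>.\<close>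

definition tuples :: "'v set \<Rightarrow> ('v \<Rightarrow> complex^2^2) set" where
  "tuples V = {\<omega>. (\<forall>v\<in>V. \<omega> v \<in> sl2) \<and> (\<forall>v. v \<notin> V \<longrightarrow> \<omega> v = 0)}"

text \<open>The degree 1 element \<open>\<Sum>v. v\<^sup>* \<otimes> \<omega>\<^sub>v\<close>.\<close>

definition one_form :: "('v \<Rightarrow> complex^2^2) \<Rightarrow> 'v list \<Rightarrow> complex^2^2" where
  "one_form \<omega> w = (case w of [v] \<Rightarrow> \<omega> v | _ \<Rightarrow> 0)"

definition flat_connections :: "'v set \<Rightarrow> 'v set set \<Rightarrow> ('v \<Rightarrow> complex^2^2) set" where
  "flat_connections V E = {\<omega> \<in> tuples V.
     raag_class mat_scale sl2 V E
       (raag_diff (one_form \<omega>)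
         + (\<lambda>w. mat_scale (1/2) (conv lie_bracket (one_form \<omega>) (one_form \<omega>) w)))
     = raag_class mat_scale sl2 V E 0}"

definition d_omega :: "(complex^2^2 \<Rightarrow> complex^'n^'n) \<Rightarrow> ('v \<Rightarrow> complex^2^2) \<Rightarrow>
    ('v list \<Rightarrow> complex^'n) \<Rightarrow> 'v list \<Rightarrow> complex^'n" where
  "d_omega \<theta> \<omega> \<alpha> = raag_diff \<alpha> + conv (\<lambda>g x. \<theta> g *v x) (one_form \<omega>) \<alpha>"

text \<open>Cocycles, coboundaries and cohomology of \<open>(A\<^sub>\<Gamma> \<otimes> \<complex>\<^sup>n, d_omega)\<close> in degree 1, given by
  representatives in \<open>T \<otimes> \<complex>\<^sup>n\<close>; both sets of representatives are saturated with respect to the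
  degree 1 part of \<open>I \<otimes> \<complex>\<^sup>n\<close>, so the quotient below is the cohomology of the quotient complex.\<close>

definition cocycles1 :: "'v set \<Rightarrow> 'v set set \<Rightarrow> (complex^2^2 \<Rightarrow> complex^'n^'n) \<Rightarrow>
    ('v \<Rightarrow> complex^2^2) \<Rightarrow> ('v list \<Rightarrow> complex^'n) set" where
  "cocycles1 V E \<theta> \<omega> = {\<alpha> \<in> tensor_alg_deg 1 V UNIV.
     raag_class (*s) UNIV V E (d_omega \<theta> \<omega> \<alpha>) = raag_class (*s) UNIV V E 0}"

definition coboundaries1 :: "'v set \<Rightarrow> 'v set set \<Rightarrow> (complex^2^2 \<Rightarrow> complex^'n^'n) \<Rightarrow>
    ('v \<Rightarrow> complex^2^2) \<Rightarrow> ('v list \<Rightarrow> complex^'n) set" where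
  "coboundaries1 V E \<theta> \<omega> = {\<alpha> \<in> tensor_alg_deg 1 V UNIV.
     \<exists>\<beta> \<in> tensor_alg_deg 0 V UNIV.
       raag_class (*s) UNIV V E \<alpha> = raag_class (*s) UNIV V E (d_omega \<theta> \<omega> \<beta>)}"

definition cohomology1 :: "'v set \<Rightarrow> 'v set set \<Rightarrow> (complex^2^2 \<Rightarrow> complex^'n^'n) \<Rightarrow>
    ('v \<Rightarrow> complex^2^2) \<Rightarrow> ('v list \<Rightarrow> complex^'n) set set" where
  "cohomology1 V E \<theta> \<omega> = cocycles1 V E \<theta> \<omega> //
     {(\<alpha>, \<beta>). \<alpha> \<in> cocycles1 V E \<theta> \<omega> \<and> \<beta> \<in> cocycles1 V E \<theta> \<omega> \<and>
       \<alpha> - \<beta> \<in> coboundaries1 V E \<theta> \<omega>}"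

text \<open>The zero element of the cohomology is the set of all coboundaries.\<close>

definition resonance :: "'v set \<Rightarrow> 'v set set \<Rightarrow> (complex^2^2 \<Rightarrow> complex^'n^'n) \<Rightarrow>
    ('v \<Rightarrow> complex^2^2) set" where
  "resonance V E \<theta> = {\<omega> \<in> flat_connections V E.
     cohomology1 V E \<theta> \<omega> \<noteq> {coboundaries1 V E \<theta> \<omega>}}"


definition S_set :: "'v set \<Rightarrow> 'v set set \<Rightarrow> 'v set \<Rightarrow> ('v \<Rightarrow> complex^2^2) set" where
  "S_set V E W = {\<omega> \<in> tuples V. (\<forall>v \<in> V - W. \<omega> v = 0) \<and>
     (\<forall>C \<in> components_of_induced E W. vector_space.dim mat_scale (\<omega> ` C) \<le> 1)}"

definition det_locus :: "(complex^2^2 \<Rightarrow> complex^'n^'n) \<Rightarrow> (complex^2^2) set" where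
  "det_locus \<theta> = {g \<in> sl2. det (\<theta> g) = 0}"

definition P_set :: "'v set \<Rightarrow> (complex^2^2 \<Rightarrow> complex^'n^'n) \<Rightarrow> 'v set \<Rightarrow>
    ('v \<Rightarrow> complex^2^2) set" where
  "P_set V \<theta> W = {\<omega> \<in> tuples V. (\<forall>v \<in> V - W. \<omega> v = 0) \<and>
     (\<exists>l. \<exists>g \<in> det_locus \<theta>. \<forall>v\<in>W. \<omega> v = mat_scale (l v) g)}"


text \<open>Zariski topology on the affine space \<open>\<complex>\<^sup>V \<otimes> sl2\<close>: the matrix entries of the \<open>\<omega>\<^sub>v\<close> span
  its linear functionals.\<close>

inductive_set polynomial_functions :: "(('v \<Rightarrow> complex^2^2) \<Rightarrow> complex) set" where
  const: "(\<lambda>\<omega>. c) \<in> polynomial_functions"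
| coord: "(\<lambda>\<omega>. \<omega> v $ i $ j) \<in> polynomial_functions"
| add: "p \<in> polynomial_functions \<Longrightarrow> q \<in> polynomial_functions \<Longrightarrow>
    (\<lambda>\<omega>. p \<omega> + q \<omega>) \<in> polynomial_functions"
| mult: "p \<in> polynomial_functions \<Longrightarrow> q \<in> polynomial_functions \<Longrightarrow>
    (\<lambda>\<omega>. p \<omega> * q \<omega>) \<in> polynomial_functions"

definition zariski_closed :: "'v set \<Rightarrow> ('v \<Rightarrow> complex^2^2) set \<Rightarrow> bool" where
  "zariski_closed V Z \<longleftrightarrow>
     (\<exists>P \<subseteq> polynomial_functions. Z = {\<omega> \<in> tuples V. \<forall>p\<in>P. p \<omega> = 0})"

definition zariski_irreducible :: "'v set \<Rightarrow> ('v \<Rightarrow> complex^2^2) set \<Rightarrow> bool" where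
  "zariski_irreducible V Z \<longleftrightarrow> Z \<noteq> {} \<and>
     (\<forall>A B. zariski_closed V A \<and> zariski_closed V B \<and> Z \<subseteq> A \<union> B \<longrightarrow> Z \<subseteq> A \<or> Z \<subseteq> B)"

definition irreducible_components :: "'v set \<Rightarrow> ('v \<Rightarrow> complex^2^2) set \<Rightarrow>
    ('v \<Rightarrow> complex^2^2) set set" where
  "irreducible_components V X =
     {Z. Z \<subseteq> X \<and> zariski_closed V Z \<and> zariski_irreducible V Z \<and>
       (\<forall>Z'. Z \<subseteq> Z' \<and> Z' \<subseteq> X \<and> zariski_closed V Z' \<and> zariski_irreducible V Z' \<longrightarrow> Z' = Z)}"

end

theory Submission
  imports Defs
begin

text \<open>
  Everything is read off from the support of \<open>\<omega>\<close>. In degree 2 the algebra has one basis vector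
  \<open>u\<^sup>* v\<^sup>*\<close> for each edge, so \<open>\<omega>\<close> is flat iff \<open>\<omega>\<^sub>u\<close> and \<open>\<omega>\<^sub>v\<close> commute for every edge \<open>{u, v}\<close>
  (\<open>flat_connections_iff\<close>), and a cochain \<open>(x\<^sub>v)\<close> is a cocycle iff
  \<open>\<theta> \<omega>\<^sub>u x\<^sub>v = \<theta> \<omega>\<^sub>v x\<^sub>u\<close> for every edge (\<open>resonance_iff\<close>). The centralizer in sl2 of a nonzero
  element is a line, so commuting propagates as proportionality along paths in the support \<open>W\<close>
  of \<open>\<omega>\<close>, and \<open>\<omega>\<close> lies in \<open>S\<^sub>W\<close>. Since \<open>S\<^sub>W \<subseteq> S\<^sub>W'\<close> holds exactly when \<open>W\<close> precedes \<open>W'\<close>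
  (\<open>S_set_mono\<close>, \<open>S_set_subset_imp_sub_preceq\<close>), the maximal \<open>W\<close> suffice and none is redundant.

  For the resonance variety, let \<open>\<omega>\<^sub>v = \<lambda>\<^sub>v g\<^sub>i\<close> on the components \<open>W\<^sub>i\<close> of \<open>W\<close>. Each \<open>W\<^sub>i\<close> carries the
  cocycles \<open>x\<^sub>v = \<lambda>\<^sub>v z\<close>, with \<open>z\<close> any vector (\<open>component_cocycle\<close>). With two components these
  form a space of more than \<open>n\<close> dimensions, whereas the coboundaries \<open>x\<^sub>v = \<theta> \<omega>\<^sub>v y\<close> form one of
  at most \<open>n\<close>; hence all of \<open>S\<^sub>W\<close> is resonant. With one component, they are all coboundaries iff
  \<open>\<theta> g\<close> is invertible. In the invertible case a cocycle vanishes at every vertex outside \<open>W\<close> that has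
  a neighbour in \<open>W\<close>, so another cohomology class exists only if some vertex outside \<open>W\<close> has none; adding this vertex to \<open>W\<close> produces a disconnected set (\<open>resonant_cases\<close>).

  The geometric input is kept elementary. A set is irreducible as soon as any two of its points
  lie on a polynomial curve inside it (\<open>irreducible_if_poly_curve_connected\<close>): restricted to such a
  curve, two nonzero polynomial functions have a nonzero product. For \<open>S\<^sub>W\<close> the curves
  interpolate scalars and generators linearly. For \<open>P\<^sub>W\<close> the generator has to stay in the zero
  locus of \<open>det \<circ> \<theta>\<close>, and this locus is either sl2 or the nilpotent cone
  (\<open>det_locus_dichotomy\<close>), where the cone is the image of the plane under
  \<open>(p, q) \<mapsto> (p q, p\<^sup>2, - q\<^sup>2)\<close>.
\<close>

section \<open>Matrices in sl2\<close>

lemma mat_scale_component [simp]: "mat_scale c A $ i $ j = c * A $ i $ j"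
  by (simp add: mat_scale_def)

lemma vector_space_mat_scale: "vector_space (mat_scale :: complex \<Rightarrow> complex^'n^'m \<Rightarrow> complex^'n^'m)"
  by unfold_locales (simp_all add: vec_eq_iff algebra_simps)

lemma mat_scale_zero [simp]: "mat_scale 0 A = 0" "mat_scale c 0 = 0"
  by (simp_all add: vec_eq_iff)

lemma mat_scale_one [simp]: "mat_scale 1 A = A"
  by (simp add: vec_eq_iff)

lemma mat_scale_mat_scale [simp]: "mat_scale c (mat_scale d A) = mat_scale (c * d) A"
  by (simp add: vec_eq_iff)

lemma mat_scale_mult_vec: "mat_scale c A *v x = c *s (A *v x)"
  by (simp add: vec_eq_iff matrix_vector_mult_def sum_distrib_left algebra_simps)

lemma mat_scale_matrix_mult [simp]:
  "mat_scale c A ** B = mat_scale c (A ** B)" "A ** mat_scale c B = mat_scale c (A ** B)"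
  by (simp_all add: vec_eq_iff matrix_matrix_mult_def sum_distrib_left algebra_simps)

lemma matrix_mult_distribs:
  fixes A B C :: "complex^'n^'n"
  shows "(A + B) ** C = A ** C + B ** C" "(A - B) ** C = A ** C - B ** C"
    "A ** (B + C) = A ** B + A ** C" "A ** (B - C) = A ** B - A ** C"
  by (simp_all add: vec_eq_iff matrix_matrix_mult_def sum.distrib sum_subtractf algebra_simps)

lemma mem_sl2: "A \<in> sl2 \<longleftrightarrow> A $ 2 $ 2 = - A $ 1 $ 1"
  unfolding sl2_def trace_def sum_2 mem_Collect_eq by (simp add: add_eq_0_iff)

lemma subspace_sl2: "module.subspace mat_scale sl2"
proof -
  interpret vector_space "mat_scale :: complex \<Rightarrow> complex^2^2 \<Rightarrow> complex^2^2"
    by (rule vector_space_mat_scale)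
  show ?thesis by (auto simp: subspace_def mem_sl2)
qed

lemma sl2_closed:
  "0 \<in> sl2" "A \<in> sl2 \<Longrightarrow> mat_scale c A \<in> sl2" "A \<in> sl2 \<Longrightarrow> B \<in> sl2 \<Longrightarrow> A + B \<in> sl2"
  by (auto simp: mem_sl2 algebra_simps)

lemma lie_bracket_in_sl2: "lie_bracket A B \<in> sl2"
  by (simp add: lie_bracket_def sl2_def trace_sub trace_mul_sym[of A B])

text \<open>All \<open>2 \<times> 2\<close> minors vanish: a polynomial form of the condition that the span of the two
  matrices has dimension at most 1.\<close>

definition parallel :: "complex^2^2 \<Rightarrow> complex^2^2 \<Rightarrow> bool" where
  "parallel A B \<longleftrightarrow> (\<forall>i j k l. A $ i $ j * B $ k $ l = A $ k $ l * B $ i $ j)"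

lemma parallel_refl: "parallel A A"
  and parallel_sym: "parallel A B \<Longrightarrow> parallel B A"
  and parallel_zero [simp]: "parallel 0 A" "parallel A 0"
  by (auto simp: parallel_def mult.commute)

lemma parallel_multiples: "parallel (mat_scale a A) (mat_scale b A)"
  by (simp add: parallel_def)

lemma parallelD:
  assumes "parallel A B" "A \<noteq> 0"
  obtains c where "B = mat_scale c A"
proof -
  obtain i j where ij: "A $ i $ j \<noteq> 0"
    using assms(2) by (auto simp: vec_eq_iff)
  have "B = mat_scale (B $ i $ j / A $ i $ j) A"
    using assms(1) ij unfolding parallel_def vec_eq_iff
    by (auto simp: field_simps)
  then show thesis using that by blast
qed

lemma parallel_trans:
  assumes "parallel A B" "parallel B C" "B \<noteq> 0"
  shows "parallel A C"
  by (metis assms parallelD parallel_multiples parallel_sym)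

text \<open>The centralizer in sl2 of a nonzero element is the line that it spans.\<close>

lemma lie_bracket_eq_0_iff_parallel:
  assumes "A \<in> sl2" "B \<in> sl2"
  shows "lie_bracket A B = 0 \<longleftrightarrow> parallel A B"
proof -
  have A: "A$2$2 = - A$1$1" and B: "B$2$2 = - B$1$1" using assms by (auto simp: mem_sl2)
  have "lie_bracket A B = 0 \<longleftrightarrow> A$1$2 * B$2$1 = A$2$1 * B$1$2
     \<and> A$1$1 * B$1$2 = A$1$2 * B$1$1 \<and> A$1$1 * B$2$1 = A$2$1 * B$1$1"
    unfolding lie_bracket_def vec_eq_iff forall_2 matrix_matrix_mult_def
    by (auto simp: sum_2 A B algebra_simps)
  also have "\<dots> \<longleftrightarrow> parallel A B"
    unfolding parallel_def forall_2 A B by (auto simp: algebra_simps)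
  finally show ?thesis .
qed

lemma dim_le_1_iff_pairwise_parallel:
  assumes "finite S"
  shows "vector_space.dim mat_scale S \<le> 1 \<longleftrightarrow> (\<forall>A\<in>S. \<forall>B\<in>S. parallel A B)"
proof -
  interpret vector_space "mat_scale :: complex \<Rightarrow> complex^2^2 \<Rightarrow> complex^2^2"
    by (rule vector_space_mat_scale)
  show ?thesis
  proof
    assume d: "dim S \<le> 1"
    obtain B where B: "B \<subseteq> S" "independent B" "S \<subseteq> span B" "card B = dim S"
      by (rule basis_exists)
    have "finite B" using B(1) assms finite_subset by blast
    with B(4) d obtain g where "B \<subseteq> {g}"
      by (metis One_nat_def card_le_Suc0_iff_eq subsetI singletonI all_not_in_conv)
    then have "S \<subseteq> span {g}" using B(3) span_mono by blast
    then have "\<exists>c. A = mat_scale c g" if "A \<in> S" for A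
      using that by (auto simp: span_singleton)
    then show "\<forall>A\<in>S. \<forall>B\<in>S. parallel A B"
      by (metis parallel_multiples)
  next
    assume p: "\<forall>A\<in>S. \<forall>B\<in>S. parallel A B"
    have "\<exists>g. S \<subseteq> span {g}"
    proof (cases "S \<subseteq> {0}")
      case True
      then have "S \<subseteq> span {0}" using span_superset by blast
      then show ?thesis by blast
    next
      case False
      then obtain g where g: "g \<in> S" "g \<noteq> 0" by blast
      have "S \<subseteq> span {g}"
      proof
        fix x assume "x \<in> S"
        then obtain c where "x = mat_scale c g" using p g parallelD by blast
        then show "x \<in> span {g}" unfolding span_singleton by blast
      qed
      then show ?thesis by blast
    qed
    then obtain g where "S \<subseteq> span {g}" ..
    then show "dim S \<le> 1" using dim_le_card[of S "{g}"] by simp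
  qed
qed

definition sl2_matrix :: "complex \<Rightarrow> complex \<Rightarrow> complex \<Rightarrow> complex^2^2" where
  "sl2_matrix a b c = vector [vector [a, b], vector [c, - a]]"

lemma sl2_matrix_components [simp]:
  "sl2_matrix a b c $ 1 $ 1 = a" "sl2_matrix a b c $ 1 $ 2 = b"
  "sl2_matrix a b c $ 2 $ 1 = c" "sl2_matrix a b c $ 2 $ 2 = - a"
  by (simp_all add: sl2_matrix_def)

lemma sl2_matrix_in_sl2 [simp]: "sl2_matrix a b c \<in> sl2"
  by (simp add: mem_sl2)

lemma sl2_matrix_eqI: "A \<in> sl2 \<Longrightarrow> A $ 1 $ 1 = a \<Longrightarrow> A $ 1 $ 2 = b \<Longrightarrow> A $ 2 $ 1 = c \<Longrightarrow> A = sl2_matrix a b c"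
  by (simp add: vec_eq_iff forall_2 mem_sl2)

lemma sl2_cases:
  assumes "A \<in> sl2"
  obtains a b c where "A = sl2_matrix a b c"
  using sl2_matrix_eqI[OF assms] by blast

lemma sl2_matrix_ops:
  "sl2_matrix a b c + sl2_matrix a' b' c' = sl2_matrix (a + a') (b + b') (c + c')"
  "mat_scale s (sl2_matrix a b c) = sl2_matrix (s * a) (s * b) (s * c)"
  "lie_bracket (sl2_matrix a b c) (sl2_matrix a' b' c') =
     sl2_matrix (b * c' - b' * c) (2 * (a * b' - a' * b)) (2 * (c * a' - c' * a))"
  "(0 :: complex^2^2) = sl2_matrix 0 0 0"
  by (simp_all add: vec_eq_iff forall_2 lie_bracket_def matrix_matrix_mult_def sum_2 algebra_simps)

lemma sl2_matrix_eq_iff: "sl2_matrix a b c = sl2_matrix a' b' c' \<longleftrightarrow> a = a' \<and> b = b' \<and> c = c'"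
  by (auto simp: vec_eq_iff forall_2)

lemma det_sl2_matrix: "det (sl2_matrix a b c) = - (a * a) - b * c"
  by (simp add: det_2)

section \<open>The singular locus of a representation\<close>

lemma rep_add:
  "sl2_representation \<theta> \<Longrightarrow> A \<in> sl2 \<Longrightarrow> B \<in> sl2 \<Longrightarrow> \<theta> (A + B) = \<theta> A + \<theta> B"
  and rep_scale: "sl2_representation \<theta> \<Longrightarrow> A \<in> sl2 \<Longrightarrow> \<theta> (mat_scale c A) = mat_scale c (\<theta> A)"
  and rep_bracket:
  "sl2_representation \<theta> \<Longrightarrow> A \<in> sl2 \<Longrightarrow> B \<in> sl2 \<Longrightarrow>
     \<theta> (lie_bracket A B) = lie_bracket (\<theta> A) (\<theta> B)"
  by (auto simp: sl2_representation_def)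

lemma rep_zero: "sl2_representation \<theta> \<Longrightarrow> \<theta> 0 = 0"
  using rep_scale[of \<theta> 0 0] by (simp add: sl2_closed)

lemma det_eq_0_iff_kernel:
  fixes A :: "complex^'n^'n"
  shows "det A = 0 \<longleftrightarrow> (\<exists>x. x \<noteq> 0 \<and> A *v x = 0)"
  by (metis invertible_det_nz invertible_left_inverse matrix_left_invertible_ker)

lemma det_nz_imp_surj:
  fixes A :: "complex^'n^'n"
  assumes "det A \<noteq> 0" shows "\<exists>x. A *v x = y"
  by (metis assms invertible_det_nz invertible_right_inverse matrix_right_invertible_surjective surjD)

lemma surj_imp_det_nz:
  fixes A :: "complex^'n^'n"
  assumes "\<And>y. \<exists>x. A *v x = y" shows "det A \<noteq> 0"
  by (metis assms invertible_det_nz invertible_right_inverse matrix_right_invertible_surjective surj_def)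

lemma det_zero_matrix: "det (0 :: complex^'n^'n) = 0"
  unfolding det_eq_0_iff_kernel by (intro exI[of _ "vec 1"]) (simp add: vec_eq_iff)

lemma det_mat_scale_eq_0_iff:
  fixes A :: "complex^'n^'n"
  assumes "c \<noteq> 0" shows "det (mat_scale c A) = 0 \<longleftrightarrow> det A = 0"
  using assms by (simp add: det_eq_0_iff_kernel mat_scale_mult_vec)

text \<open>For invertible \<open>X\<close> the hypothesis reads \<open>H = X H X\<^sup>-\<^sup>1 + 2\<close>, and the two sides have
  different traces.\<close>

lemma commutator_double_imp_singular:
  fixes H X :: "complex^'n^'n"
  assumes "lie_bracket H X = mat_scale 2 X"
  shows "det X = 0"
proof (rule ccontr)
  assume "det X \<noteq> 0"
  then obtain Y where Y: "X ** Y = mat 1" "Y ** X = mat 1"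
    by (metis invertible_det_nz invertible_def)
  have "(H ** X) ** Y = (X ** H + mat_scale 2 X) ** Y"
    using assms unfolding lie_bracket_def by (metis add.commute diff_add_cancel)
  then have "H = (X ** H) ** Y + mat_scale 2 (mat 1)"
    by (simp add: matrix_mul_assoc[symmetric] Y matrix_mult_distribs)
  then have "trace H = trace ((X ** H) ** Y) + trace (mat_scale 2 (mat 1 :: complex^'n^'n))"
    by (metis trace_add)
  moreover have "trace ((X ** H) ** Y) = trace H"
    by (subst trace_mul_sym) (simp add: matrix_mul_assoc Y)
  moreover have "trace (mat_scale 2 (mat 1 :: complex^'n^'n)) = 2 * of_nat CARD('n)"
    by (simp add: trace_def mat_def)
  ultimately show False by simp
qed

definition matrix_power :: "complex^'n^'n \<Rightarrow> nat \<Rightarrow> complex^'n^'n" where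
  "matrix_power X k = (((**) X) ^^ k) (mat 1)"

lemma matrix_power_simps [simp]:
  "matrix_power X 0 = mat 1" "matrix_power X (Suc k) = X ** matrix_power X k"
  by (simp_all add: matrix_power_def)

lemma linear_lie_bracket: "linear (lie_bracket H)"
proof
  show "lie_bracket H (A + B) = lie_bracket H A + lie_bracket H B" for A B
    by (simp add: lie_bracket_def matrix_mult_distribs)
  show "lie_bracket H (r *\<^sub>R A) = r *\<^sub>R lie_bracket H A" for r A
    by (simp add: lie_bracket_def vec_eq_iff matrix_matrix_mult_def scaleR_sum_right[symmetric] scaleR_diff_right)
qed

text \<open>The power \<open>X\<^sup>k\<close> satisfies \<open>[H, X\<^sup>k] = 2 k X\<^sup>k\<close>, while the operator \<open>[H, -]\<close> is bounded; so
  \<open>X\<^sup>k\<close> must vanish once \<open>2 k\<close> exceeds its norm.\<close>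

lemma commutator_double_imp_nilpotent:
  fixes H X :: "complex^'n^'n"
  assumes HX: "lie_bracket H X = mat_scale 2 X"
  shows "\<exists>N. \<forall>k\<ge>N. matrix_power X k = 0"
proof -
  obtain K where K: "\<And>A. norm (lie_bracket H A) \<le> K * norm A"
    using linear_bounded[OF linear_lie_bracket] by metis
  have br: "lie_bracket H (matrix_power X k) = (2 * real k) *\<^sub>R matrix_power X k" for k
  proof (induction k)
    case 0 then show ?case by (simp add: lie_bracket_def)
  next
    case (Suc k)
    have "lie_bracket H (X ** matrix_power X k) =
        lie_bracket H X ** matrix_power X k + X ** lie_bracket H (matrix_power X k)"
      by (simp add: lie_bracket_def matrix_mult_distribs matrix_mul_assoc)
    also have "\<dots> = mat_scale 2 (X ** matrix_power X k)
        + mat_scale (2 * of_nat k) (X ** matrix_power X k)"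
    proof -
      have "(2 * real k) *\<^sub>R A = mat_scale (2 * of_nat k) A" for A :: "complex^'n^'n"
        unfolding vec_eq_iff by (simp, simp add: scaleR_conv_of_real)
      then show ?thesis by (simp add: HX Suc.IH)
    qed
    also have "\<dots> = (2 * real (Suc k)) *\<^sub>R (X ** matrix_power X k)"
      unfolding vec_eq_iff by (simp, simp add: scaleR_conv_of_real algebra_simps)
    finally show ?case by simp
  qed
  obtain N where N: "K < real N" using reals_Archimedean2 by blast
  have "matrix_power X k = 0" if "k \<ge> N" for k
  proof (rule ccontr)
    assume "matrix_power X k \<noteq> 0"
    then have pos: "norm (matrix_power X k) > 0" by simp
    have "(2 * real k) * norm (matrix_power X k) \<le> K * norm (matrix_power X k)"
      using K[of "matrix_power X k"] by (simp add: br)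
    then have "2 * real k \<le> K" using pos by (simp add: mult_le_cancel_right)
    moreover have "real N \<le> real k" using that by simp
    ultimately show False using N by linarith
  qed
  then show ?thesis by blast
qed

text \<open>The third commutator with \<open>X\<close> is zero, so \<open>M0 + t M1 + t\<^sup>2 M2\<close> is the conjugate of \<open>M0\<close> by
  \<open>exp (t X)\<close> and \<open>exp (t X) v\<close> is in its kernel. As \<open>X\<close> is nilpotent, the exponential is a finite
  sum, and the claim can be verified one power of \<open>t\<close> at a time.\<close>

lemma kernel_along_unipotent_orbit:
  fixes X M0 M1 M2 :: "complex^'n^'n" and t :: complex
  assumes nil: "\<forall>k\<ge>N. matrix_power X k = 0"
    and M1: "lie_bracket X M0 = M1" and M2: "lie_bracket X M1 = mat_scale 2 M2"
    and M3: "lie_bracket X M2 = 0"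
    and v: "M0 *v v = 0" "v \<noteq> 0"
  shows "\<exists>w. w \<noteq> 0 \<and> (M0 + mat_scale t M1 + mat_scale (t^2) M2) *v w = 0"
proof -
  define u where "u k = (1 / fact k) *s (matrix_power X k *v v)" for k
  have u0: "u 0 = v" by (simp add: u_def)
  have Xu: "X *v u k = of_nat (Suc k) *s u (Suc k)" for k
    by (simp add: u_def vector_scalar_commute[symmetric] matrix_vector_mul_assoc[symmetric])
       (simp add: vec_eq_iff vector_scalar_commute field_simps del: of_nat_Suc flip: of_nat_Suc)
  have uN: "u k = 0" if "k \<ge> N" for k using nil that by (simp add: u_def)
  have XM0: "X *v (M0 *v y) = M0 *v (X *v y) + M1 *v y" for y
    unfolding M1[symmetric] lie_bracket_def
    by (simp add: matrix_vector_mul_assoc matrix_vector_mult_diff_rdistrib)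
  have XM1: "X *v (M1 *v y) = M1 *v (X *v y) + 2 *s (M2 *v y)" for y
    using M2 unfolding lie_bracket_def mat_scale_mult_vec[symmetric]
    by (metis (no_types) M2 lie_bracket_def diff_add_cancel
          matrix_vector_mul_assoc matrix_vector_mult_add_rdistrib add.commute)
  have XM2: "X *v (M2 *v y) = M2 *v (X *v y)" for y
    using M3 unfolding lie_bracket_def by (simp add: matrix_vector_mul_assoc)
  \<comment> \<open>The coefficient of \<open>t\<^sup>k\<close> in \<open>(M0 + t M1 + t\<^sup>2 M2) exp (t X) v\<close>.\<close>
  define s where "s k = M0 *v u k + (if k \<ge> 1 then M1 *v u (k - 1) else 0)
      + (if k \<ge> 2 then M2 *v u (k - 2) else 0)" for k
  have step: "X *v s k = of_nat (Suc k) *s s (Suc k)" for k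
  proof -
    consider "k = 0" | "k = 1" | m where "k = Suc (Suc m)"
      by (metis One_nat_def not0_implies_Suc)
    then show ?thesis
    proof cases
      case 1
      then show ?thesis by (simp add: s_def XM0 Xu)
    next
      case 2
      then show ?thesis
        by (simp add: s_def XM0 XM1 Xu matrix_vector_right_distrib vector_scalar_commute)
           (simp add: vec_eq_iff algebra_simps)
    next
      case 3
      then show ?thesis
        by (simp add: s_def XM0 XM1 XM2 Xu matrix_vector_right_distrib vector_scalar_commute)
           (simp add: vec_eq_iff algebra_simps)
    qed
  qed
  have s0: "s k = 0" for k
  proof (induction k)
    case 0 then show ?case by (simp add: s_def u0 v)
  next
    case (Suc k)
    then have "of_nat (Suc k) *s s (Suc k) = 0" using step[of k] by simp
    then show ?case by (simp add: vec_eq_iff del: of_nat_Suc)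
  qed
  define w where "w = (\<Sum>k<N. t^k *s u k)"
  let ?M = "M0 + mat_scale t M1 + mat_scale (t^2) M2"
  have "?M *v w = 0"
  proof -
    have shift: "c *s (A *v w) = (\<Sum>k<N+2. if k \<ge> d then (c * t^(k-d)) *s (A *v u (k-d)) else 0)"
      if "d \<le> 2" for A :: "complex^'n^'n" and c d
    proof -
      have "(\<Sum>k<N+2. if k \<ge> d then (c * t^(k-d)) *s (A *v u (k-d)) else 0)
         = (\<Sum>k\<in>{d..<N+2}. (c * t^(k-d)) *s (A *v u (k-d)))"
        by (rule sum.mono_neutral_cong_right) auto
      also have "\<dots> = (\<Sum>k<N+2-d. (c * t^k) *s (A *v u k))"
        by (rule sum.reindex_bij_witness[of _ "\<lambda>k. k + d" "\<lambda>k. k - d"]) auto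
      also have "\<dots> = (\<Sum>k<N. (c * t^k) *s (A *v u k))"
        using that by (intro sum.mono_neutral_right) (auto simp: uN)
      also have "\<dots> = c *s (\<Sum>k<N. t^k *s (A *v u k))"
        by (simp add: vec.scale_sum_right)
      also have "(\<Sum>k<N. t^k *s (A *v u k)) = A *v w"
        unfolding w_def by (induction N) (simp_all add: matrix_vector_right_distrib vector_scalar_commute)
      finally show ?thesis by simp
    qed
    have "?M *v w = 1 *s (M0 *v w) + t *s (M1 *v w) + (t^2) *s (M2 *v w)"
      by (simp add: matrix_vector_mult_add_rdistrib mat_scale_mult_vec)
    also have "\<dots> = (\<Sum>k<N+2. if k \<ge> 0 then (1 * t^(k-0)) *s (M0 *v u (k-0)) else 0)
        + (\<Sum>k<N+2. if k \<ge> 1 then (t * t^(k-1)) *s (M1 *v u (k-1)) else 0)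
        + (\<Sum>k<N+2. if k \<ge> 2 then (t^2 * t^(k-2)) *s (M2 *v u (k-2)) else 0)"
      by (intro arg_cong2[where f = "(+)"] shift) simp_all
    also have "\<dots> = (\<Sum>k<N+2. t^k *s s k)"
      unfolding sum.distrib[symmetric]
    proof (intro sum.cong refl)
      fix k
      have "t * t^(k-1) = t^k" if "k \<ge> 1" using that by (metis power_Suc Suc_diff_1 One_nat_def Suc_le_eq)
      moreover have "t^2 * t^(k-2) = t^k" if "k \<ge> 2" using that by (metis power_add le_add_diff_inverse)
      ultimately show "(if k \<ge> 0 then (1 * t^(k-0)) *s (M0 *v u (k-0)) else 0)
          + (if k \<ge> 1 then (t * t^(k-1)) *s (M1 *v u (k-1)) else 0)
          + (if k \<ge> 2 then (t^2 * t^(k-2)) *s (M2 *v u (k-2)) else 0) = t^k *s s k"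
        by (auto simp: s_def vec.scale_right_distrib)
    qed
    finally show ?thesis by (simp add: s0)
  qed
  moreover have "w \<noteq> 0"
  proof
    assume w0: "w = 0"
    \<comment> \<open>The highest power of \<open>X\<close> that does not kill \<open>v\<close> maps \<open>w\<close> to a nonzero multiple of \<open>u K\<close>.\<close>
    obtain K where K: "u K \<noteq> 0" "\<And>k. k > K \<Longrightarrow> u k = 0"
    proof -
      have sub: "{k. u k \<noteq> 0} \<subseteq> {..<N}"
      proof
        fix k assume "k \<in> {k. u k \<noteq> 0}"
        then show "k \<in> {..<N}" using uN[of k] by (cases "k \<ge> N") auto
      qed
      have fin: "finite {k. u k \<noteq> 0}" by (rule finite_subset[OF sub]) simp
      have "0 \<in> {k. u k \<noteq> 0}" using u0 v by simp
      then have "Max {k. u k \<noteq> 0} \<in> {k. u k \<noteq> 0}" using Max_in[OF fin] by blast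
      moreover have "u k = 0" if "k > Max {k. u k \<noteq> 0}" for k
      proof (rule ccontr)
        assume "u k \<noteq> 0"
        then have "k \<le> Max {k. u k \<noteq> 0}" using Max_ge[OF fin] by simp
        then show False using that by simp
      qed
      ultimately show thesis using that by blast
    qed
    have pow: "\<exists>c. matrix_power X K *v u k = c *s u (K + k)" for k
    proof (induction K)
      case 0 then show ?case by (auto intro: exI[of _ 1])
    next
      case (Suc K)
      then obtain c where "matrix_power X K *v u k = c *s u (K + k)" by blast
      then have "matrix_power X (Suc K) *v u k = (c * of_nat (Suc (K + k))) *s u (Suc K + k)"
        by (simp add: matrix_vector_mul_assoc[symmetric] vector_scalar_commute Xu)
           (simp add: vec_eq_iff algebra_simps)
      then show ?case by blast
    qed
    have "K < N" using K uN not_less by blast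
    have "matrix_power X K *v w = (\<Sum>k<N. t^k *s (matrix_power X K *v u k))"
      unfolding w_def by (induction N) (simp_all add: matrix_vector_right_distrib vector_scalar_commute)
    also have "\<dots> = (\<Sum>k\<in>{0}. t^k *s (matrix_power X K *v u k))"
    proof (rule sum.mono_neutral_right)
      show "\<forall>k\<in>{..<N} - {0}. t ^ k *s (matrix_power X K *v u k) = 0"
      proof
        fix k assume "k \<in> {..<N} - {0}"
        then have "u (K + k) = 0" using K(2)[of "K + k"] by auto
        then show "t ^ k *s (matrix_power X K *v u k) = 0" using pow[of k] by auto
      qed
    qed (use \<open>K < N\<close> in auto)
    also have "\<dots> = fact K *s u K"
      by (simp add: u_def vec_eq_iff)
    finally show False using K(1) w0 by (simp add: vec_eq_iff)
  qed
  ultimately show ?thesis by blast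
qed

text \<open>The zero locus of \<open>det \<circ> \<theta>\<close> is invariant under conjugation by \<open>exp (t x)\<close>, although \<open>\<theta>\<close> is
  only given as a representation of the Lie algebra.\<close>

lemma singular_along_unipotent_orbit:
  assumes rep: "sl2_representation \<theta>" and sl2: "g \<in> sl2" "h \<in> sl2" "x \<in> sl2"
    and hx: "lie_bracket h x = mat_scale 2 x"
    and cube: "lie_bracket x (lie_bracket x (lie_bracket x g)) = 0"
    and sing: "det (\<theta> g) = 0"
  shows "det (\<theta> (g + mat_scale t (lie_bracket x g)
                  + mat_scale (t^2/2) (lie_bracket x (lie_bracket x g)))) = 0"
proof -
  let ?a = "lie_bracket x"
  note [simp] = rep_add[OF rep] rep_scale[OF rep] rep_bracket[OF rep] sl2 sl2_closed lie_bracket_in_sl2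
  have "lie_bracket (\<theta> h) (\<theta> x) = mat_scale 2 (\<theta> x)"
    using arg_cong[OF hx, of \<theta>] by simp
  then obtain N where N: "\<forall>k\<ge>N. matrix_power (\<theta> x) k = 0"
    using commutator_double_imp_nilpotent by blast
  obtain v where v: "v \<noteq> 0" "\<theta> g *v v = 0" using sing det_eq_0_iff_kernel by blast
  have "\<exists>w. w \<noteq> 0 \<and> (\<theta> g + mat_scale t (\<theta> (?a g)) + mat_scale (t^2) (mat_scale (1/2) (\<theta> (?a (?a g))))) *v w = 0"
  proof (rule kernel_along_unipotent_orbit[OF N _ _ _ v(2,1)])
    have "lie_bracket (\<theta> x) (\<theta> (?a (?a g))) = 0"
      using arg_cong[OF cube, of \<theta>] rep_zero[OF rep] by simp
    then show "lie_bracket (\<theta> x) (mat_scale (1/2) (\<theta> (?a (?a g)))) = 0"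
      by (simp add: lie_bracket_def vec_eq_iff)
  qed simp_all
  then show ?thesis by (simp add: det_eq_0_iff_kernel)
qed

text \<open>A nilpotent \<open>g\<close> satisfies \<open>[h, g] = 2 g\<close> for a suitable \<open>h\<close>, so \<open>\<theta> g\<close> is singular. The other
  elements are all conjugate to nonzero multiples of \<open>diag (1, -1)\<close> under the group generated by
  the exponentials of the two root vectors, so either all of them have a singular image or none
  has.\<close>

lemma det_locus_dichotomy:
  fixes \<theta> :: "complex^2^2 \<Rightarrow> complex^'n^'n"
  assumes rep: "sl2_representation \<theta>"
  shows "det_locus \<theta> = sl2 \<or> det_locus \<theta> = {g \<in> sl2. det g = 0}"
proof -
  define D where "D a b c \<longleftrightarrow> det (\<theta> (sl2_matrix a b c)) = 0" for a b c
  have nilpotent: "D a b c" if "det (sl2_matrix a b c) = 0" for a b c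
  proof -
    have "\<exists>h\<in>sl2. lie_bracket h (sl2_matrix a b c) = mat_scale 2 (sl2_matrix a b c)"
    proof (cases "b = 0")
      case True
      then have "a = 0" using that by (simp add: det_sl2_matrix)
      then show ?thesis using True
        by (intro bexI[of _ "sl2_matrix (-1) 0 0"]) (auto simp: sl2_matrix_ops)
    next
      case False
      then have "2 * (- 2 * a / b * a - c) = 2 * c"
        using that by (simp add: det_sl2_matrix field_simps)
      then show ?thesis using False
        by (intro bexI[of _ "sl2_matrix 1 0 (- 2 * a / b)"]) (auto simp: sl2_matrix_ops sl2_matrix_eq_iff)
    qed
    then obtain h where "h \<in> sl2" "lie_bracket h (sl2_matrix a b c) = mat_scale 2 (sl2_matrix a b c)"
      by blast
    then have "lie_bracket (\<theta> h) (\<theta> (sl2_matrix a b c)) = mat_scale 2 (\<theta> (sl2_matrix a b c))"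
      by (metis rep rep_bracket rep_scale sl2_matrix_in_sl2)
    then show ?thesis unfolding D_def by (rule commutator_double_imp_singular)
  qed
  have e1: "D (a + t * c) (b - 2 * t * a - t^2 * c) c" if "D a b c" for a b c t
  proof -
    have "det (\<theta> (sl2_matrix a b c + mat_scale t (lie_bracket (sl2_matrix 0 1 0) (sl2_matrix a b c))
      + mat_scale (t^2/2) (lie_bracket (sl2_matrix 0 1 0) (lie_bracket (sl2_matrix 0 1 0) (sl2_matrix a b c))))) = 0"
      by (rule singular_along_unipotent_orbit[OF rep, where h = "sl2_matrix 1 0 0"])
         (use that in \<open>auto simp: D_def sl2_matrix_ops\<close>)
    then show ?thesis unfolding D_def sl2_matrix_ops by (simp add: algebra_simps)
  qed
  have f1: "D (a - t * b) b (c + 2 * t * a - t^2 * b)" if "D a b c" for a b c t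
  proof -
    have "det (\<theta> (sl2_matrix a b c + mat_scale t (lie_bracket (sl2_matrix 0 0 1) (sl2_matrix a b c))
      + mat_scale (t^2/2) (lie_bracket (sl2_matrix 0 0 1) (lie_bracket (sl2_matrix 0 0 1) (sl2_matrix a b c))))) = 0"
      by (rule singular_along_unipotent_orbit[OF rep, where h = "sl2_matrix (-1) 0 0"])
         (use that in \<open>auto simp: D_def sl2_matrix_ops\<close>)
    then show ?thesis unfolding D_def sl2_matrix_ops by (simp add: algebra_simps)
  qed
  have e: "D (a + t * c) (b - 2 * t * a - t^2 * c) c \<longleftrightarrow> D a b c" for a b c t
    using e1[of a b c t] e1[of "a + t * c" "b - 2 * t * a - t^2 * c" c "- t"]
    by (auto simp: power2_eq_square algebra_simps)
  have f: "D (a - t * b) b (c + 2 * t * a - t^2 * b) \<longleftrightarrow> D a b c" for a b c t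
    using f1[of a b c t] f1[of "a - t * b" b "c + 2 * t * a - t^2 * b" "- t"]
    by (auto simp: power2_eq_square algebra_simps)
  have scale: "D a 0 0 \<longleftrightarrow> D 1 0 0" if "a \<noteq> 0" for a
    using det_mat_scale_eq_0_iff[OF that, of "\<theta> (sl2_matrix 1 0 0)"]
      rep_scale[OF rep, of "sl2_matrix 1 0 0" a]
    by (simp add: D_def sl2_matrix_ops)
  have diag: "D a b c \<longleftrightarrow> D 1 0 0" if nz: "det (sl2_matrix a b c) \<noteq> 0" for a b c
  proof (cases "b = 0")
    case True
    then have a: "a \<noteq> 0" using nz by (simp add: det_sl2_matrix)
    have "D a b c \<longleftrightarrow> D a 0 0" using f[of a "- c / (2 * a)" 0 c] True a by simp
    then show ?thesis using scale[OF a] by simp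
  next
    case False
    \<comment> \<open>An eigenvalue of the matrix; the parameter \<open>t\<close> below makes it upper triangular with \<open>- r\<close> in
      the corner.\<close>
    define r where "r = csqrt (a^2 + b * c)"
    have r2: "r^2 = a^2 + b * c" by (simp add: r_def)
    have r: "r \<noteq> 0"
    proof
      assume "r = 0"
      then have "a^2 + b * c = 0" using r2 by simp
      then have "- (a * a) - b * c = 0" by algebra
      then show False using nz by (simp add: det_sl2_matrix)
    qed
    define t where "t = (a + r) / b"
    have tb: "t * b = a + r" using False by (simp add: t_def)
    have "b * (c + 2 * t * a - t^2 * b) = b * c + 2 * a * (t * b) - (t * b)^2"
      by (simp add: power2_eq_square algebra_simps)
    also have "\<dots> = 0" unfolding tb using r2 by (simp add: power2_eq_square algebra_simps)
    finally have "c + 2 * t * a - t^2 * b = 0" using False by simp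
    then have "D a b c \<longleftrightarrow> D (- r) b 0" using f[of a t b c] tb by simp
    also have "\<dots> \<longleftrightarrow> D (- r) 0 0" using e[of "- r" "- b / (2 * r)" 0 b] r by simp
    finally show ?thesis using scale[of "- r"] r by simp
  qed
  show ?thesis
  proof (cases "D 1 0 0")
    case True
    then have "D a b c" for a b c using nilpotent diag by blast
    then have "det_locus \<theta> = sl2" by (auto simp: det_locus_def D_def elim: sl2_cases)
    then show ?thesis ..
  next
    case False
    then have "D a b c \<longleftrightarrow> det (sl2_matrix a b c) = 0" for a b c using nilpotent diag by blast
    then have "det_locus \<theta> = {g \<in> sl2. det g = 0}"
      by (auto simp: det_locus_def D_def elim!: sl2_cases)
    then show ?thesis ..
  qed
qed

section \<open>Connected components of induced subgraphs\<close>

text \<open>The equivalence relation whose classes are the components. Pairs of vertices are easier to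
  compare across different \<open>W\<close> than the classes themselves.\<close>

definition connected_in :: "'v set set \<Rightarrow> 'v set \<Rightarrow> ('v \<times> 'v) set" where
  "connected_in E W =
     {(u, v). u \<in> W \<and> v \<in> W \<and> (u, v) \<in> {(x, y). x \<in> W \<and> y \<in> W \<and> {x, y} \<in> E}\<^sup>*}"

lemma components_eq: "components_of_induced E W = W // connected_in E W"
  by (simp add: components_of_induced_def connected_in_def)

lemma equiv_connected_in: "equiv W (connected_in E W)"
proof (rule equivI)
  show "refl_on W (connected_in E W)" by (auto simp: refl_on_def connected_in_def)
  have "sym ({(x, y). x \<in> W \<and> y \<in> W \<and> {x, y} \<in> E}\<^sup>*)"
    by (rule sym_rtrancl) (auto simp: sym_def insert_commute)
  then show "sym (connected_in E W)" by (auto simp: sym_def connected_in_def)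
  show "trans (connected_in E W)" unfolding trans_def connected_in_def
    by (auto intro: rtrancl_trans)
qed (auto simp: connected_in_def)

lemma connected_in_refl: "v \<in> W \<Longrightarrow> (v, v) \<in> connected_in E W"
  and connected_in_sym: "(u, v) \<in> connected_in E W \<Longrightarrow> (v, u) \<in> connected_in E W"
  and connected_in_trans:
  "(u, v) \<in> connected_in E W \<Longrightarrow> (v, w) \<in> connected_in E W \<Longrightarrow> (u, w) \<in> connected_in E W"
  using equiv_connected_in[of W E] by (auto simp: equiv_def refl_on_def dest: symD transD)

lemma connected_in_subset: "(u, v) \<in> connected_in E W \<Longrightarrow> u \<in> W \<and> v \<in> W"
  by (simp add: connected_in_def)

lemma connected_in_edge:
  "u \<in> W \<Longrightarrow> v \<in> W \<Longrightarrow> {u, v} \<in> E \<Longrightarrow> (u, v) \<in> connected_in E W"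
  by (auto simp: connected_in_def)

lemma connected_in_mono: "W \<subseteq> W' \<Longrightarrow> connected_in E W \<subseteq> connected_in E W'"
  unfolding connected_in_def using rtrancl_mono[of "{(x, y). x \<in> W \<and> y \<in> W \<and> {x, y} \<in> E}"
      "{(x, y). x \<in> W' \<and> y \<in> W' \<and> {x, y} \<in> E}"] by auto

lemma connected_in_induct [consumes 1, case_names base step]:
  assumes "(a, v) \<in> connected_in E W" and base: "P a"
    and step: "\<And>x y. x \<in> W \<Longrightarrow> y \<in> W \<Longrightarrow> {x, y} \<in> E \<Longrightarrow> P x \<Longrightarrow> P y"
  shows "P v"
proof -
  have "(a, v) \<in> {(x, y). x \<in> W \<and> y \<in> W \<and> {x, y} \<in> E}\<^sup>*"
    using assms(1) by (simp add: connected_in_def)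
  then show ?thesis by induction (auto intro: base step)
qed

lemma in_component_iff:
  "C \<in> components_of_induced E W \<Longrightarrow> u \<in> C \<Longrightarrow> v \<in> C \<longleftrightarrow> (u, v) \<in> connected_in E W"
  unfolding components_eq quotient_def
  by (auto intro: connected_in_sym connected_in_trans)

lemma component_ofI: "v \<in> W \<Longrightarrow> connected_in E W `` {v} \<in> components_of_induced E W"
  by (simp add: components_eq quotientI)

lemma component_nonempty: "C \<in> components_of_induced E W \<Longrightarrow> C \<noteq> {}"
  unfolding components_eq using equiv_connected_in in_quotient_imp_non_empty by blast

lemma component_subset: "C \<in> components_of_induced E W \<Longrightarrow> C \<subseteq> W"
  unfolding components_eq using equiv_connected_in in_quotient_imp_subset by blast

lemma component_eqI:
  "C \<in> components_of_induced E W \<Longrightarrow> v \<in> C \<Longrightarrow> C = connected_in E W `` {v}"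
  using in_component_iff by fastforce

lemma component_map_eq:
  assumes "W \<subseteq> W'" "C \<in> components_of_induced E W" "v \<in> C"
  shows "component_map E W W' C = connected_in E W' `` {v}"
  unfolding component_map_def
proof (rule the_equality)
  have "v \<in> W'" using assms component_subset by blast
  moreover have "C \<subseteq> connected_in E W' `` {v}"
    using component_eqI[OF assms(2,3)] connected_in_mono[OF assms(1)] by blast
  ultimately show "connected_in E W' `` {v} \<in> components_of_induced E W' \<and> C \<subseteq> connected_in E W' `` {v}"
    by (simp add: component_ofI)
next
  show "C' = connected_in E W' `` {v}" if "C' \<in> components_of_induced E W' \<and> C \<subseteq> C'" for C'
    using component_eqI[of C' E W' v] that assms(3) by blast
qed

text \<open>The component map sends the class of \<open>u\<close> in \<open>W\<close> to the class of \<open>u\<close> in \<open>W'\<close>, so its injectivity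
  means that enlarging \<open>W\<close> to \<open>W'\<close> connects no further vertices of \<open>W\<close>.\<close>

lemma sub_preceq_iff:
  "sub_preceq E W W' \<longleftrightarrow> W \<subseteq> W' \<and>
     (\<forall>u\<in>W. \<forall>v\<in>W. (u, v) \<in> connected_in E W' \<longrightarrow> (u, v) \<in> connected_in E W)"
proof (cases "W \<subseteq> W'")
  case sub: True
  have "inj_on (component_map E W W') (components_of_induced E W) \<longleftrightarrow>
     (\<forall>u\<in>W. \<forall>v\<in>W. (u, v) \<in> connected_in E W' \<longrightarrow> (u, v) \<in> connected_in E W)" (is "?L \<longleftrightarrow> ?R")
  proof
    assume inj: ?L
    show ?R
    proof (intro ballI impI)
      fix u v assume uv: "u \<in> W" "v \<in> W" "(u, v) \<in> connected_in E W'"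
      have "connected_in E W' `` {u} = connected_in E W' `` {v}"
        by (rule equiv_class_eq[OF equiv_connected_in uv(3)])
      then have "component_map E W W' (connected_in E W `` {u}) = component_map E W W' (connected_in E W `` {v})"
        using component_map_eq[OF sub component_ofI[OF uv(1)], of u]
          component_map_eq[OF sub component_ofI[OF uv(2)], of v]
          connected_in_refl[OF uv(1)] connected_in_refl[OF uv(2)] by simp
      then have "connected_in E W `` {u} = connected_in E W `` {v}"
        using inj component_ofI uv(1,2) unfolding inj_on_def by metis
      then show "(u, v) \<in> connected_in E W" using connected_in_refl[OF uv(2), of E] by blast
    qed
  next
    assume R: ?R
    show ?L
    proof (rule inj_onI)
      fix C D assume C: "C \<in> components_of_induced E W" and D: "D \<in> components_of_induced E W"
        and eq: "component_map E W W' C = component_map E W W' D"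
      obtain u v where uv: "u \<in> C" "v \<in> D" using component_nonempty C D by blast
      then have W: "u \<in> W" "v \<in> W" using C D component_subset by blast+
      have "connected_in E W' `` {u} = connected_in E W' `` {v}"
        using eq component_map_eq[OF sub C uv(1)] component_map_eq[OF sub D uv(2)] by simp
      then have "(u, v) \<in> connected_in E W'" using W sub connected_in_refl[of v W' E] by blast
      then have "(u, v) \<in> connected_in E W" using R W by blast
      then have "connected_in E W `` {u} = connected_in E W `` {v}"
        by (rule equiv_class_eq[OF equiv_connected_in])
      then show "C = D" using component_eqI[OF C uv(1)] component_eqI[OF D uv(2)] by simp
    qed
  qed
  then show ?thesis using sub by (simp add: sub_preceq_def)
qed (simp add: sub_preceq_def)

lemma sub_preceq_refl: "sub_preceq E W W"
  and sub_preceq_trans: "sub_preceq E W W' \<Longrightarrow> sub_preceq E W' W'' \<Longrightarrow> sub_preceq E W W''"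
  unfolding sub_preceq_iff by blast+

lemma components_empty_iff: "components_of_induced E W = {} \<longleftrightarrow> W = {}"
  by (auto simp: components_eq quotient_def)

lemma finite_components: "finite W \<Longrightarrow> finite (components_of_induced E W)"
  unfolding components_eq by (rule finite_quotient) (auto simp: connected_in_def)

lemma num_components_gt_1_iff:
  assumes "finite W"
  shows "num_components E W > 1 \<longleftrightarrow> (\<exists>u\<in>W. \<exists>v\<in>W. (u, v) \<notin> connected_in E W)"
proof -
  have "num_components E W \<le> 1 \<longleftrightarrow>
      (\<forall>C\<in>components_of_induced E W. \<forall>D\<in>components_of_induced E W. C = D)"
    using card_le_Suc0_iff_eq[OF finite_components[OF assms]] by (simp add: num_components_def)
  also have "\<dots> \<longleftrightarrow> (\<forall>u\<in>W. \<forall>v\<in>W. (u, v) \<in> connected_in E W)"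
  proof
    assume L: "\<forall>C\<in>components_of_induced E W. \<forall>D\<in>components_of_induced E W. C = D"
    show "\<forall>u\<in>W. \<forall>v\<in>W. (u, v) \<in> connected_in E W"
    proof (intro ballI)
      fix u v assume uv: "u \<in> W" "v \<in> W"
      then have "connected_in E W `` {u} = connected_in E W `` {v}"
        using L component_ofI by metis
      then show "(u, v) \<in> connected_in E W" using connected_in_refl[OF uv(2), of E] by auto
    qed
  next
    assume R: "\<forall>u\<in>W. \<forall>v\<in>W. (u, v) \<in> connected_in E W"
    show "\<forall>C\<in>components_of_induced E W. \<forall>D\<in>components_of_induced E W. C = D"
    proof (intro ballI)
      fix C D assume CD: "C \<in> components_of_induced E W" "D \<in> components_of_induced E W"
      then obtain u v where uv: "u \<in> C" "v \<in> D" using component_nonempty by blast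
      then have "u \<in> W" "v \<in> W"
        using component_subset[OF CD(1)] component_subset[OF CD(2)] by auto
      then have "(u, v) \<in> connected_in E W" using R by simp
      then have "v \<in> C" using in_component_iff[OF CD(1) uv(1)] by simp
      then show "C = D" using component_eqI[OF CD(1)] component_eqI[OF CD(2) uv(2)] by simp
    qed
  qed
  finally show ?thesis by (auto simp: not_le[symmetric])
qed

lemma num_components_eq_0_iff: "finite W \<Longrightarrow> num_components E W = 0 \<longleftrightarrow> W = {}"
  using finite_components[of W E] components_empty_iff[of E W] by (auto simp: num_components_def)

lemma num_components_eq_1_iff:
  assumes "finite W"
  shows "num_components E W = 1 \<longleftrightarrow> W \<noteq> {} \<and> (\<forall>u\<in>W. \<forall>v\<in>W. (u, v) \<in> connected_in E W)"
proof -
  have "num_components E W = 1 \<longleftrightarrow> num_components E W \<noteq> 0 \<and> \<not> num_components E W > 1" by linarith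
  then show ?thesis using num_components_gt_1_iff[OF assms] num_components_eq_0_iff[OF assms] by metis
qed

lemma num_components_gt_1_mono:
  assumes "sub_preceq E W W'" "finite W'" "num_components E W > 1"
  shows "num_components E W' > 1"
proof -
  have "finite W" using assms(1,2) finite_subset by (auto simp: sub_preceq_iff)
  then show ?thesis
    using assms num_components_gt_1_iff[of W E] num_components_gt_1_iff[of W' E]
    unfolding sub_preceq_iff by blast
qed

text \<open>The predicate \<open>Q\<close> records what the maximal set should inherit from \<open>W\<close>, such as having
  several components.\<close>

lemma ex_maximal_above:
  assumes "finite V" "W \<subseteq> V"
    and "\<And>W W'. Q W \<Longrightarrow> W' \<subseteq> V \<Longrightarrow> sub_preceq E W W' \<Longrightarrow> Q W'" "Q W"
  shows "\<exists>W'. sub_preceq E W W' \<and> Q W' \<and> preceq_maximal V E W'"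
  using assms(2,4)
proof (induction "card (V - W)" arbitrary: W rule: less_induct)
  case less
  show ?case
  proof (cases "preceq_maximal V E W")
    case True
    then show ?thesis using less.prems sub_preceq_refl by blast
  next
    case False
    then obtain W' where W': "W' \<subseteq> V" "sub_preceq E W W'" "W' \<noteq> W"
      using less.prems by (auto simp: preceq_maximal_def)
    then have "V - W' \<subset> V - W" using less.prems by (auto simp: sub_preceq_iff)
    then have "card (V - W') < card (V - W)" using assms(1) by (intro psubset_card_mono) auto
    then obtain W'' where "sub_preceq E W' W''" "Q W''" "preceq_maximal V E W''"
      using less.hyps W' assms(3) less.prems(2) by blast
    then show ?thesis using W'(2) sub_preceq_trans by blast
  qed
qed

text \<open>Having several components is inherited by larger sets in the order, so a set that is maximal
  among those with several components is maximal outright.\<close>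

lemma maximal_disconnected_iff:
  assumes "finite V" "W \<subseteq> V" "num_components E W > 1"
  shows "(\<nexists>W'. W' \<subseteq> V \<and> W' \<noteq> W \<and> sub_preceq E W W' \<and> num_components E W' > 1)
    \<longleftrightarrow> preceq_maximal V E W"
  using assms num_components_gt_1_mono finite_subset unfolding preceq_maximal_def by metis

section \<open>The strata and the order on vertex sets\<close>

lemma tuplesD: "\<omega> \<in> tuples V \<Longrightarrow> \<omega> v \<in> sl2"
  by (cases "v \<in> V") (auto simp: tuples_def sl2_closed)

lemma S_set_iff:
  assumes "finite V" "W \<subseteq> V"
  shows "\<omega> \<in> S_set V E W \<longleftrightarrow> \<omega> \<in> tuples V \<and> (\<forall>v. v \<notin> W \<longrightarrow> \<omega> v = 0) \<and>
     (\<forall>(u, v)\<in>connected_in E W. parallel (\<omega> u) (\<omega> v))"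
proof -
  have "vector_space.dim mat_scale (\<omega> ` C) \<le> 1 \<longleftrightarrow> (\<forall>u\<in>C. \<forall>v\<in>C. parallel (\<omega> u) (\<omega> v))"
    if "C \<in> components_of_induced E W" for C
  proof -
    have "finite (\<omega> ` C)"
      using finite_subset[OF subset_trans[OF component_subset[OF that] assms(2)] assms(1)] by simp
    then show ?thesis using dim_le_1_iff_pairwise_parallel[of "\<omega> ` C"] by simp
  qed
  moreover have "(\<forall>C\<in>components_of_induced E W. \<forall>u\<in>C. \<forall>v\<in>C. parallel (\<omega> u) (\<omega> v)) \<longleftrightarrow>
      (\<forall>(u, v)\<in>connected_in E W. parallel (\<omega> u) (\<omega> v))" (is "?L \<longleftrightarrow> ?R")
  proof
    assume L: ?L
    have "parallel (\<omega> u) (\<omega> v)" if "(u, v) \<in> connected_in E W" for u v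
      using L that component_ofI[of u W E] connected_in_subset[OF that] connected_in_refl[of u W E] by blast
    then show ?R by blast
  next
    assume ?R then show ?L using in_component_iff[of _ E W] by auto
  qed
  moreover have "(\<forall>v\<in>V - W. \<omega> v = 0) \<longleftrightarrow> (\<forall>v. v \<notin> W \<longrightarrow> \<omega> v = 0)" if "\<omega> \<in> tuples V"
    using that by (auto simp: tuples_def)
  ultimately show ?thesis unfolding S_set_def by auto
qed

lemma S_set_mono:
  assumes "finite V" "W' \<subseteq> V" "sub_preceq E W W'"
  shows "S_set V E W \<subseteq> S_set V E W'"
proof -
  have W: "W \<subseteq> V" "W \<subseteq> W'" using assms by (auto simp: sub_preceq_iff)
  show ?thesis
  proof
    fix \<omega> assume "\<omega> \<in> S_set V E W"
    then have \<omega>: "\<omega> \<in> tuples V" "\<And>v. v \<notin> W \<Longrightarrow> \<omega> v = 0"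
      "\<And>u v. (u, v) \<in> connected_in E W \<Longrightarrow> parallel (\<omega> u) (\<omega> v)"
      using S_set_iff[OF assms(1) W(1)] by auto
    have "parallel (\<omega> u) (\<omega> v)" if "(u, v) \<in> connected_in E W'" for u v
    proof (cases "u \<in> W \<and> v \<in> W")
      case True
      then show ?thesis using that assms(3) \<omega>(3) by (auto simp: sub_preceq_iff)
    next
      case False
      then show ?thesis using \<omega>(2) by auto
    qed
    moreover have "\<omega> v = 0" if "v \<notin> W'" for v using \<omega>(2) W(2) that by blast
    ultimately show "\<omega> \<in> S_set V E W'" unfolding S_set_iff[OF assms(1,2)] using \<omega>(1) by auto
  qed
qed

text \<open>Two tuples test the inclusion: a constant nonzero one detects \<open>W \<subseteq> W'\<close>, and one with
  independent values on a component of \<open>W\<close> and on the rest of \<open>W\<close> detects vertices that become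
  connected in \<open>W'\<close>.\<close>

lemma S_set_subset_imp_sub_preceq:
  assumes "finite V" "W \<subseteq> V" "W' \<subseteq> V" "S_set V E W \<subseteq> S_set V E W'"
  shows "sub_preceq E W W'"
proof -
  have [simp]: "sl2_matrix 0 1 0 \<noteq> 0" by (simp add: sl2_matrix_ops sl2_matrix_eq_iff)
  have "W \<subseteq> W'"
  proof -
    have "(\<lambda>v. if v \<in> W then sl2_matrix 0 1 0 else 0) \<in> S_set V E W"
      unfolding S_set_iff[OF assms(1,2)] using assms(2) parallel_refl
      by (auto simp: tuples_def sl2_closed)
    then have "(\<lambda>v. if v \<in> W then sl2_matrix 0 1 0 else 0) \<in> S_set V E W'" using assms(4) by blast
    then show ?thesis unfolding S_set_iff[OF assms(1,3)] by (auto split: if_splits)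
  qed
  moreover have "(u, v) \<in> connected_in E W"
    if uv: "u \<in> W" "v \<in> W" "(u, v) \<in> connected_in E W'" for u v
  proof (rule ccontr)
    assume n: "(u, v) \<notin> connected_in E W"
    define \<omega> where "\<omega> w = (if w \<notin> W then 0 else if (u, w) \<in> connected_in E W then sl2_matrix 0 1 0
        else sl2_matrix 0 0 1)" for w
    have "\<omega> \<in> S_set V E W"
      unfolding S_set_iff[OF assms(1,2)] using assms(2)
      by (auto simp: tuples_def sl2_closed \<omega>_def parallel_refl
            dest: connected_in_trans connected_in_sym connected_in_subset)
    then have "\<omega> \<in> S_set V E W'" using assms(4) by blast
    then have "parallel (\<omega> u) (\<omega> v)" using uv(3) unfolding S_set_iff[OF assms(1,3)] by blast
    then have "parallel (sl2_matrix 0 1 0) (sl2_matrix 0 0 1)"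
      using n uv by (simp add: \<omega>_def connected_in_refl)
    then show False by (simp add: parallel_def forall_2)
  qed
  ultimately show ?thesis by (simp add: sub_preceq_iff)
qed

section \<open>Flatness and resonance in coordinates\<close>

lemma conv_Nil: "conv b \<alpha> \<beta> [] = b (\<alpha> []) (\<beta> [])"
  and conv_single: "conv b \<alpha> \<beta> [u] = b (\<alpha> []) (\<beta> [u]) + b (\<alpha> [u]) (\<beta> [])"
  and conv_pair: "conv b \<alpha> \<beta> [u, v] =
    b (\<alpha> []) (\<beta> [u, v]) + b (\<alpha> [u]) (\<beta> [v]) + b (\<alpha> [u, v]) (\<beta> [])"
  by (simp_all add: conv_def)

lemma one_form_eq_0: "length w \<noteq> 1 \<Longrightarrow> one_form \<omega> w = 0"
  by (auto simp: one_form_def split: list.splits)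

lemma conv_one_form:
  assumes "\<And>x. b 0 x = 0"
  shows "conv b (one_form \<omega>) \<alpha> w = (case w of [] \<Rightarrow> 0 | v # w' \<Rightarrow> b (\<omega> v) (\<alpha> w'))"
proof (cases w)
  case Nil
  then show ?thesis by (simp add: conv_Nil one_form_def assms)
next
  case (Cons v w')
  have "conv b (one_form \<omega>) \<alpha> w = (\<Sum>k\<in>{1}. b (one_form \<omega> (take k w)) (\<alpha> (drop k w)))"
    unfolding conv_def
  proof (rule sum.mono_neutral_right)
    show "\<forall>k\<in>{..length w} - {1}. b (one_form \<omega> (take k w)) (\<alpha> (drop k w)) = 0"
    proof
      fix k assume k: "k \<in> {..length w} - {1}"
      then have "length (take k w) \<noteq> 1" by auto
      then have "one_form \<omega> (take k w) = 0" by (rule one_form_eq_0)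
      then show "b (one_form \<omega> (take k w)) (\<alpha> (drop k w)) = 0" by (simp add: assms)
    qed
  qed (auto simp: Cons)
  then show ?thesis by (simp add: Cons one_form_def)
qed

text \<open>The relators have degree 2, and their coefficients agree on \<open>u v\<close> and \<open>v u\<close> for an edge: the
  square of a vector is symmetric, and the monomial of a non-edge vanishes there. Both properties
  pass to the two-sided ideal in degrees up to 2.\<close>

lemma relator_low_degree:
  assumes "r \<in> raag_relators V E"
  shows "r [] = 0" "r [u] = 0" "{u, v} \<in> E \<Longrightarrow> r [u, v] = r [v, u]"
proof -
  consider x where "x [] = 0" "r = conv (*) x x" | a b where "{a, b} \<notin> E" "r = word [a, b]"
  proof -
    have "x [] = 0" if "x \<in> tensor_alg_deg 1 V UNIV" for x :: "'a list \<Rightarrow> complex"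
    proof (rule ccontr)
      assume "x [] \<noteq> 0"
      then have "length ([] :: 'a list) = 1" using that unfolding tensor_alg_deg_def by blast
      then show False by simp
    qed
    then show thesis using assms that unfolding raag_relators_def by blast
  qed
  then have "r [] = 0 \<and> r [u] = 0 \<and> ({u, v} \<in> E \<longrightarrow> r [u, v] = r [v, u])"
  proof cases
    case 1
    then show ?thesis by (simp add: conv_Nil conv_single conv_pair)
  next
    case 2
    then show ?thesis by (auto simp: word_def insert_commute)
  qed
  then show "r [] = 0" "r [u] = 0" "{u, v} \<in> E \<Longrightarrow> r [u, v] = r [v, u]" by simp_all
qed

lemma ideal_low_degree:
  assumes "i \<in> raag_ideal V E"
  shows "i [] = 0 \<and> i [u] = 0 \<and> ({u, v} \<in> E \<longrightarrow> i [u, v] = i [v, u])"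
  using assms
proof induction
  case (gen r p q)
  then show ?case
    using relator_low_degree[OF gen(1)] by (auto simp: conv_Nil conv_single conv_pair)
qed auto

lemma ideal_tensor_low_degree:
  assumes "vector_space sc" "\<alpha> \<in> ideal_tensor sc M V E"
  shows "\<alpha> [] = 0 \<and> \<alpha> [u] = 0 \<and> ({u, v} \<in> E \<longrightarrow> \<alpha> [u, v] = \<alpha> [v, u])"
proof -
  interpret vector_space sc by fact
  show ?thesis using assms(2)
  proof induction
    case (pure i m)
    then show ?case using ideal_low_degree[OF pure(1), of u v] by auto
  qed auto
qed

lemma conv_word_Nil_left: "conv (*) (\<lambda>w. c * word [] w) p w = c * p w"
proof -
  have "conv (*) (\<lambda>w. c * word [] w) p w = (\<Sum>k\<in>{0}. c * word [] (take k w) * p (drop k w))"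
    unfolding conv_def by (rule sum.mono_neutral_right) (auto simp: word_def)
  then show ?thesis by (simp add: word_def)
qed

lemma conv_word_Nil_right: "conv (*) p (word []) w = p w"
proof -
  have "conv (*) p (word []) w = (\<Sum>k\<in>{length w}. p (take k w) * word [] (drop k w))"
    unfolding conv_def by (rule sum.mono_neutral_right) (auto simp: word_def)
  then show ?thesis by (simp add: word_def)
qed

lemma scaled_relator_in_ideal:
  assumes "r \<in> raag_relators V E" shows "(\<lambda>w. c * r w) \<in> raag_ideal V E"
proof -
  have "(\<lambda>w. d * word [] w) \<in> tensor_alg V UNIV" for d
    by (auto simp: tensor_alg_def word_def intro: finite_subset[of _ "{[]}"])
  from raag_ideal.gen[OF assms this[of c] this[of 1]] show ?thesis
    by (simp add: conv_word_Nil_left[abs_def] conv_word_Nil_right[abs_def])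
qed

text \<open>Polarization of the relators \<open>x x\<close> with \<open>x\<close> of degree 1.\<close>

lemma symmetric_word_in_ideal:
  assumes "u \<in> V" "v \<in> V"
  shows "(\<lambda>w. 1/2 * (word [u, v] w + word [v, u] w)) \<in> raag_ideal V E"
proof -
  have deg1: "(\<lambda>w. a * word [u] w + b * word [v] w) \<in> tensor_alg_deg 1 V UNIV" for a b
  proof -
    have supp: "w = [u] \<or> w = [v]" if "a * word [u] w + b * word [v] w \<noteq> 0" for w
      using that by (auto simp: word_def split: if_splits)
    then have "{w. a * word [u] w + b * word [v] w \<noteq> 0} \<subseteq> {[u], [v]}" by blast
    then have "finite {w. a * word [u] w + b * word [v] w \<noteq> 0}" by (rule finite_subset) simp
    moreover have "w \<in> lists V \<and> length w = 1" if "a * word [u] w + b * word [v] w \<noteq> 0" for w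
      using supp[OF that] assms by auto
    ultimately show ?thesis unfolding tensor_alg_deg_def tensor_alg_def by simp
  qed
  define q where "q a b = conv (*) (\<lambda>w. a * word [u] w + b * word [v] w)
      (\<lambda>w. a * word [u] w + b * word [v] w)" for a b
  have q: "(\<lambda>w. c * q a b w) \<in> raag_ideal V E" for a b c
    by (rule scaled_relator_in_ideal) (use deg1 in \<open>auto simp: raag_relators_def q_def\<close>)
  have qval: "q a b w = (case w of [x, y] \<Rightarrow> (a * word [u] [x] + b * word [v] [x]) * (a * word [u] [y] + b * word [v] [y]) | _ \<Rightarrow> 0)" for a b w
  proof -
    have nz: "a * word [u] l + b * word [v] l = 0" if "length l \<noteq> 1" for l
      using that by (auto simp: word_def)
    show ?thesis
    proof (cases "length w = 2")
      case True
      then obtain x y where "w = [x, y]"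
        by (metis One_nat_def Suc_1 length_0_conv length_Suc_conv)
      then show ?thesis by (simp add: q_def conv_pair nz)
    next
      case False
      have "q a b w = 0" unfolding q_def conv_def
      proof (intro sum.neutral ballI)
        fix k assume "k \<in> {..length w}"
        then have "length (take k w) \<noteq> 1 \<or> length (drop k w) \<noteq> 1" using False by auto
        then show "(a * word [u] (take k w) + b * word [v] (take k w)) *
            (a * word [u] (drop k w) + b * word [v] (drop k w)) = 0"
          using nz by auto
      qed
      then show ?thesis using False by (auto split: list.splits)
    qed
  qed
  have "(\<lambda>w. 1/2 * q 1 1 w) + ((\<lambda>w. (-1/2) * q 1 0 w) + (\<lambda>w. (-1/2) * q 0 1 w)) \<in> raag_ideal V E"
    by (intro raag_ideal.add q)
  also have "(\<lambda>w. 1/2 * q 1 1 w) + ((\<lambda>w. (-1/2) * q 1 0 w) + (\<lambda>w. (-1/2) * q 0 1 w))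
      = (\<lambda>w. 1/2 * (word [u, v] w + word [v, u] w))"
  proof
    fix w
    show "((\<lambda>w. 1/2 * q 1 1 w) + ((\<lambda>w. (-1/2) * q 1 0 w) + (\<lambda>w. (-1/2) * q 0 1 w))) w
      = 1/2 * (word [u, v] w + word [v, u] w)"
    proof (cases "\<exists>x y. w = [x, y]")
      case True
      then obtain x y where w: "w = [x, y]" by blast
      have pair: "word [s, t] [x, y] = word [s] [x] * word [t] [y]" for s t by (simp add: word_def)
      show ?thesis by (simp add: qval w pair algebra_simps)
    next
      case False
      then have "word [s, t] w = 0" for s t by (auto simp: word_def)
      moreover have "q a b w = 0" for a b using False unfolding qval by (auto split: list.splits)
      ultimately show ?thesis by simp
    qed
  qed
  finally show ?thesis .
qed

lemma ideal_tensor_sum: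
  "finite A \<Longrightarrow> (\<And>a. a \<in> A \<Longrightarrow> f a \<in> ideal_tensor sc M V E) \<Longrightarrow>
    (\<lambda>w. \<Sum>a\<in>A. f a w) \<in> ideal_tensor sc M V E"
proof (induction A rule: finite_induct)
  case empty
  have "(\<lambda>w. \<Sum>a\<in>{}. f a w) = 0" by (simp add: fun_eq_iff)
  then show ?case using ideal_tensor.zero by metis
next
  case (insert a A)
  have "f a + (\<lambda>w. \<Sum>a\<in>A. f a w) \<in> ideal_tensor sc M V E"
    using insert by (intro ideal_tensor.add) auto
  then show ?case using insert by (simp add: plus_fun_def)
qed

text \<open>Homogeneous of degree 2, the shape of \<open>[\<omega>, \<omega>] / 2\<close> and of the differential of a cochain of
  degree 1.\<close>

definition quadratic :: "'v set \<Rightarrow> 'm::zero set \<Rightarrow> ('v list \<Rightarrow> 'm) \<Rightarrow> bool" where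
  "quadratic V M \<alpha> \<longleftrightarrow> (\<forall>w. \<alpha> w \<in> M) \<and> (\<forall>w. \<alpha> w \<noteq> 0 \<longrightarrow> (\<exists>u\<in>V. \<exists>v\<in>V. w = [u, v]))"

lemma quadratic_in_tensor_alg:
  assumes "finite V" "quadratic V M \<alpha>" shows "\<alpha> \<in> tensor_alg V M"
proof -
  have "{w. \<alpha> w \<noteq> 0} \<subseteq> (\<lambda>(u, v). [u, v]) ` (V \<times> V)"
    using assms(2) unfolding quadratic_def by fastforce
  then have "finite {w. \<alpha> w \<noteq> 0}" using assms(1) finite_subset by blast
  then show ?thesis using assms(2) by (fastforce simp: tensor_alg_def quadratic_def)
qed

text \<open>Modulo the ideal a non-edge \<open>u v\<close> vanishes and an edge satisfies \<open>u v = - v u\<close>, so only the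
  differences \<open>\<alpha> [u, v] - \<alpha> [v, u]\<close> over the edges survive.\<close>

lemma quadratic_in_ideal_tensor_iff:
  assumes "finite V" "vector_space sc" "quadratic V M \<alpha>"
  shows "\<alpha> \<in> ideal_tensor sc M V E \<longleftrightarrow> (\<forall>u v. {u, v} \<in> E \<longrightarrow> \<alpha> [u, v] = \<alpha> [v, u])"
proof
  show "\<forall>u v. {u, v} \<in> E \<longrightarrow> \<alpha> [u, v] = \<alpha> [v, u]" if "\<alpha> \<in> ideal_tensor sc M V E"
    using ideal_tensor_low_degree[OF assms(2) that] by blast
next
  interpret vector_space sc by fact
  assume sym: "\<forall>u v. {u, v} \<in> E \<longrightarrow> \<alpha> [u, v] = \<alpha> [v, u]"
  \<comment> \<open>An edge \<open>u v\<close> is replaced by \<open>(u v + v u) / 2\<close>, which lies in the ideal; summed over both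
    orientations this reproduces \<open>\<alpha>\<close>.\<close>
  define c where "c p = (case p of (u, v) \<Rightarrow> if {u, v} \<in> E then 1/2 else (1 :: complex))" for p :: "'a \<times> 'a"
  define d where "d p = (case p of (u, v) \<Rightarrow> if {u, v} \<in> E then 1/2 else (0 :: complex))" for p :: "'a \<times> 'a"
  define f where "f p = (\<lambda>w. sc (c p * word [fst p, snd p] w + d p * word [snd p, fst p] w) (\<alpha> [fst p, snd p]))"
    for p :: "'a \<times> 'a"
  have "f p \<in> ideal_tensor sc M V E" if "p \<in> V \<times> V" for p
    unfolding f_def
  proof (rule ideal_tensor.pure)
    show "\<alpha> [fst p, snd p] \<in> M" using assms(3) by (auto simp: quadratic_def)
    obtain u v where p: "p = (u, v)" "u \<in> V" "v \<in> V" using \<open>p \<in> V \<times> V\<close> by auto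
    show "(\<lambda>w. c p * word [fst p, snd p] w + d p * word [snd p, fst p] w) \<in> raag_ideal V E"
    proof (cases "{u, v} \<in> E")
      case True
      then show ?thesis using symmetric_word_in_ideal[OF p(2,3), of E]
        by (simp add: p c_def d_def algebra_simps)
    next
      case False
      then have "word [u, v] \<in> raag_relators V E" using p by (auto simp: raag_relators_def)
      from scaled_relator_in_ideal[OF this, of 1] False show ?thesis by (simp add: p c_def d_def)
    qed
  qed
  then have "(\<lambda>w. \<Sum>p\<in>V\<times>V. f p w) \<in> ideal_tensor sc M V E"
    using assms(1) by (intro ideal_tensor_sum) auto
  also have "(\<lambda>w. \<Sum>p\<in>V\<times>V. f p w) = \<alpha>"
  proof
    fix w
    show "(\<Sum>p\<in>V\<times>V. f p w) = \<alpha> w"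
    proof (cases "\<exists>a\<in>V. \<exists>b\<in>V. w = [a, b]")
      case True
      then obtain a b where w: "a \<in> V" "b \<in> V" "w = [a, b]" by blast
      have "(\<Sum>p\<in>V\<times>V. f p w) = (\<Sum>p\<in>V\<times>V. (if p = (a, b) then sc (c p) (\<alpha> [fst p, snd p]) else 0)
            + (if p = (b, a) then sc (d p) (\<alpha> [fst p, snd p]) else 0))"
      proof (rule sum.cong[OF refl])
        fix p
        have e: "word [fst p, snd p] [a, b] = (if p = (a, b) then 1 else 0)"
          "word [snd p, fst p] [a, b] = (if p = (b, a) then 1 else 0)"
          by (auto simp: word_def prod_eq_iff)
        show "f p w = (if p = (a, b) then sc (c p) (\<alpha> [fst p, snd p]) else 0)
            + (if p = (b, a) then sc (d p) (\<alpha> [fst p, snd p]) else 0)"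
          unfolding f_def w(3) e scale_left_distrib by (simp only: mult_1_right mult_zero_right scale_zero_left split: if_split) blast
      qed
      also have "\<dots> = sc (c (a, b)) (\<alpha> [a, b]) + sc (d (b, a)) (\<alpha> [b, a])"
        using w assms(1) by (simp add: sum.distrib)
      also have "\<dots> = \<alpha> w"
      proof (cases "{a, b} \<in> E")
        case True
        then have "\<alpha> [b, a] = \<alpha> [a, b]" using sym by metis
        then show ?thesis using True
          by (simp add: w c_def d_def insert_commute flip: scale_left_distrib)
      qed (simp add: w c_def d_def insert_commute)
      finally show ?thesis .
    next
      case False
      then have "\<alpha> w = 0" using assms(3) unfolding quadratic_def by blast
      moreover have "f p w = 0" if p: "p \<in> V \<times> V" for p
      proof -
        have "w \<noteq> [fst p, snd p]" "w \<noteq> [snd p, fst p]" using p False by (auto simp: mem_Times_iff)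
        then show ?thesis by (simp add: f_def word_def)
      qed
      ultimately show ?thesis by simp
    qed
  qed
  finally show "\<alpha> \<in> ideal_tensor sc M V E" .
qed

lemma raag_class_eq_iff:
  fixes sc :: "complex \<Rightarrow> 'm::ab_group_add \<Rightarrow> 'm" and \<alpha> \<beta> :: "'v list \<Rightarrow> 'm"
  assumes "vector_space sc" "module.subspace sc M" "\<alpha> \<in> tensor_alg V M"
  shows "raag_class sc M V E \<alpha> = raag_class sc M V E \<beta> \<longleftrightarrow> \<alpha> - \<beta> \<in> ideal_tensor sc M V E"
proof
  interpret vector_space sc by fact
  have neg: "- \<gamma> \<in> ideal_tensor sc M V E" if "\<gamma> \<in> ideal_tensor sc M V E" for \<gamma>
    using that
  proof induction
    case zero
    have "- (0 :: 'v list \<Rightarrow> 'm) = 0" by (simp add: fun_eq_iff)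
    then show ?case using ideal_tensor.zero by metis
  next
    case (add \<alpha> \<beta>)
    have "- (\<alpha> + \<beta>) = (- \<alpha>) + (- \<beta>)" by (simp add: fun_eq_iff)
    then show ?case using ideal_tensor.add[OF add(3,4)] by metis
  next
    case (pure i m)
    have "- m \<in> M" using pure(2) assms(2) subspace_neg by blast
    moreover have "- (\<lambda>w. sc (i w) m) = (\<lambda>w. sc (i w) (- m))" by (simp add: fun_eq_iff)
    ultimately show ?case using ideal_tensor.pure[OF pure(1)] by metis
  qed
  {
    assume "raag_class sc M V E \<alpha> = raag_class sc M V E \<beta>"
    moreover have "\<alpha> \<in> raag_class sc M V E \<alpha>"
      using assms(3) ideal_tensor.zero[of sc M V E] by (simp add: raag_class_def)
    ultimately show "\<alpha> - \<beta> \<in> ideal_tensor sc M V E" by (auto simp: raag_class_def)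
  next
    assume *: "\<alpha> - \<beta> \<in> ideal_tensor sc M V E"
    have "\<gamma> - \<alpha> \<in> ideal_tensor sc M V E \<longleftrightarrow> \<gamma> - \<beta> \<in> ideal_tensor sc M V E" for \<gamma>
    proof
      assume "\<gamma> - \<alpha> \<in> ideal_tensor sc M V E"
      from ideal_tensor.add[OF this *] show "\<gamma> - \<beta> \<in> ideal_tensor sc M V E" by simp
    next
      assume "\<gamma> - \<beta> \<in> ideal_tensor sc M V E"
      from ideal_tensor.add[OF this neg[OF *]] show "\<gamma> - \<alpha> \<in> ideal_tensor sc M V E" by simp
    qed
    then show "raag_class sc M V E \<alpha> = raag_class sc M V E \<beta>" by (simp add: raag_class_def)
  }
qed

lemma quadratic_class_eq_0_iff:
  assumes "finite V" "vector_space sc" "module.subspace sc M" "quadratic V M \<alpha>"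
  shows "raag_class sc M V E \<alpha> = raag_class sc M V E 0 \<longleftrightarrow>
    (\<forall>u v. {u, v} \<in> E \<longrightarrow> \<alpha> [u, v] = \<alpha> [v, u])"
  using raag_class_eq_iff[OF assms(2,3) quadratic_in_tensor_alg[OF assms(1,4)], of E 0]
    quadratic_in_ideal_tensor_iff[OF assms(1,2,4)] by simp

lemma flat_connections_iff:
  assumes "finite V"
  shows "\<omega> \<in> flat_connections V E \<longleftrightarrow>
    \<omega> \<in> tuples V \<and> (\<forall>u v. {u, v} \<in> E \<longrightarrow> parallel (\<omega> u) (\<omega> v))"
proof (cases "\<omega> \<in> tuples V")
  case True
  define \<xi> where "\<xi> = raag_diff (one_form \<omega>)
         + (\<lambda>w. mat_scale (1/2) (conv lie_bracket (one_form \<omega>) (one_form \<omega>) w))"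
  have \<xi>: "\<xi> w = (case w of [u, v] \<Rightarrow> mat_scale (1/2) (lie_bracket (\<omega> u) (\<omega> v)) | _ \<Rightarrow> 0)" for w
    by (auto simp: \<xi>_def raag_diff_def conv_one_form lie_bracket_def one_form_def split: list.splits)
  have "quadratic V sl2 \<xi>"
    unfolding quadratic_def
  proof (intro conjI allI impI)
    show "\<xi> w \<in> sl2" for w by (auto simp: \<xi> sl2_closed lie_bracket_in_sl2 split: list.splits)
    have z: "\<omega> v = 0" if "v \<notin> V" for v using True that by (auto simp: tuples_def)
    show "\<exists>u\<in>V. \<exists>v\<in>V. w = [u, v]" if "\<xi> w \<noteq> 0" for w
    proof -
      have "\<exists>u v. w = [u, v] \<and> lie_bracket (\<omega> u) (\<omega> v) \<noteq> 0"
        using \<open>\<xi> w \<noteq> 0\<close> unfolding \<xi> by (auto split: list.splits)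
      then obtain u v where w: "w = [u, v]" "lie_bracket (\<omega> u) (\<omega> v) \<noteq> 0" by blast
      then have "\<omega> u \<noteq> 0" "\<omega> v \<noteq> 0" by (auto simp: lie_bracket_def)
      then show ?thesis using z w(1) by blast
    qed
  qed
  from quadratic_class_eq_0_iff[OF assms vector_space_mat_scale subspace_sl2 this, of E]
  have "\<omega> \<in> flat_connections V E \<longleftrightarrow> (\<forall>u v. {u, v} \<in> E \<longrightarrow>
     mat_scale (1/2) (lie_bracket (\<omega> u) (\<omega> v)) = mat_scale (1/2) (lie_bracket (\<omega> v) (\<omega> u)))"
    using True by (simp add: flat_connections_def \<xi>_def[symmetric] \<xi>)
  also have "\<dots> \<longleftrightarrow> (\<forall>u v. {u, v} \<in> E \<longrightarrow> parallel (\<omega> u) (\<omega> v))"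
  proof -
    have "mat_scale (1/2) (lie_bracket A B) = mat_scale (1/2) (lie_bracket B A) \<longleftrightarrow> lie_bracket A B = 0" for A B :: "complex^2^2"
    proof -
      have "lie_bracket B A = - lie_bracket A B" by (simp add: lie_bracket_def)
      then show ?thesis by (simp add: vec_eq_iff)
    qed
    then show ?thesis using lie_bracket_eq_0_iff_parallel[OF tuplesD[OF True] tuplesD[OF True]] by simp
  qed
  finally show ?thesis using True by simp
qed (simp add: flat_connections_def)

lemma cohomology1_nonzero_iff:
  assumes "coboundaries1 V E \<theta> \<omega> \<subseteq> cocycles1 V E \<theta> \<omega>" "0 \<in> coboundaries1 V E \<theta> \<omega>"
    and closed: "\<And>\<alpha> \<beta>. \<alpha> \<in> coboundaries1 V E \<theta> \<omega> \<Longrightarrow> \<beta> \<in> coboundaries1 V E \<theta> \<omega> \<Longrightarrow>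
      \<alpha> - \<beta> \<in> coboundaries1 V E \<theta> \<omega>"
  shows "cohomology1 V E \<theta> \<omega> = {coboundaries1 V E \<theta> \<omega>} \<longleftrightarrow>
     cocycles1 V E \<theta> \<omega> \<subseteq> coboundaries1 V E \<theta> \<omega>"
proof -
  let ?Z = "cocycles1 V E \<theta> \<omega>" and ?B = "coboundaries1 V E \<theta> \<omega>"
  let ?R = "{(\<alpha>, \<beta>). \<alpha> \<in> ?Z \<and> \<beta> \<in> ?Z \<and> \<alpha> - \<beta> \<in> ?B}"
  have H: "cohomology1 V E \<theta> \<omega> = (\<lambda>\<alpha>. ?R `` {\<alpha>}) ` ?Z"
    by (auto simp: cohomology1_def quotient_def)
  show ?thesis
  proof
    assume "cohomology1 V E \<theta> \<omega> = {?B}"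
    then have img: "(\<lambda>\<alpha>. ?R `` {\<alpha>}) ` ?Z = {?B}" unfolding H .
    show "?Z \<subseteq> ?B"
    proof
      fix \<alpha> assume \<alpha>: "\<alpha> \<in> ?Z"
      then have "?R `` {\<alpha>} \<in> {?B}" unfolding img[symmetric] by (rule imageI)
      moreover have "\<alpha> \<in> ?R `` {\<alpha>}" using \<alpha> assms(2) by simp
      ultimately show "\<alpha> \<in> ?B" by simp
    qed
  next
    assume sub: "?Z \<subseteq> ?B"
    then have ZB: "?Z = ?B" using assms(1) by (rule subset_antisym)
    have "?R `` {\<alpha>} = ?B" if "\<alpha> \<in> ?Z" for \<alpha>
    proof -
      have "?R `` {\<alpha>} = {\<beta> \<in> ?Z. \<alpha> - \<beta> \<in> ?B}" using that by simp
      also have "\<dots> = ?B" using closed that unfolding ZB by blast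
      finally show ?thesis .
    qed
    moreover have "0 \<in> ?Z" using assms(1,2) by (rule subsetD)
    ultimately show "cohomology1 V E \<theta> \<omega> = {?B}" unfolding H by (metis (no_types, lifting) image_cong image_constant)
  qed
qed

lemma coboundaries1_iff:
  fixes V :: "'v set"
  assumes rep: "sl2_representation \<theta>" and \<omega>: "\<omega> \<in> tuples V"
    and \<alpha>: "\<alpha> \<in> tensor_alg_deg 1 V UNIV"
  shows "\<alpha> \<in> coboundaries1 V E \<theta> \<omega> \<longleftrightarrow> (\<exists>y. \<forall>v. \<alpha> [v] = \<theta> (\<omega> v) *v y)"
proof -
  have d: "d_omega \<theta> \<omega> \<beta> w = (case w of [] \<Rightarrow> 0 | v # w' \<Rightarrow> \<theta> (\<omega> v) *v \<beta> w')" for \<beta> w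
    using rep_zero[OF rep] by (simp add: d_omega_def raag_diff_def conv_one_form)
  have \<alpha>T: "\<alpha> \<in> tensor_alg V UNIV" using \<alpha> by (simp add: tensor_alg_deg_def)
  have cls: "raag_class (*s) UNIV V E \<alpha> = raag_class (*s) UNIV V E \<beta> \<longleftrightarrow>
      \<alpha> - \<beta> \<in> ideal_tensor (*s) UNIV V E" for \<beta>
    by (rule raag_class_eq_iff[OF vec.vector_space_axioms vec.subspace_UNIV \<alpha>T])
  show ?thesis
  proof
    assume "\<alpha> \<in> coboundaries1 V E \<theta> \<omega>"
    then obtain \<beta> where "raag_class (*s) UNIV V E \<alpha> = raag_class (*s) UNIV V E (d_omega \<theta> \<omega> \<beta>)"
      unfolding coboundaries1_def by blast
    then have "\<alpha> - d_omega \<theta> \<omega> \<beta> \<in> ideal_tensor (*s) UNIV V E" unfolding cls .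
    from ideal_tensor_low_degree[OF vec.vector_space_axioms this]
    have "(\<alpha> - d_omega \<theta> \<omega> \<beta>) [v] = 0" for v by simp
    then show "\<exists>y. \<forall>v. \<alpha> [v] = \<theta> (\<omega> v) *v y" by (intro exI[of _ "\<beta> []"]) (simp add: d)
  next
    assume "\<exists>y. \<forall>v. \<alpha> [v] = \<theta> (\<omega> v) *v y"
    then obtain y where y: "\<And>v. \<alpha> [v] = \<theta> (\<omega> v) *v y" by blast
    define \<beta> where "\<beta> w = (if w = [] then y else 0)" for w :: "'v list"
    have "\<beta> \<in> tensor_alg_deg 0 V UNIV"
      by (auto simp: tensor_alg_deg_def tensor_alg_def \<beta>_def intro: finite_subset[of _ "{[]}"])
    moreover have "\<alpha> = d_omega \<theta> \<omega> \<beta>"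
    proof
      fix w
      show "\<alpha> w = d_omega \<theta> \<omega> \<beta> w"
      proof (cases "length w = 1")
        case True
        then obtain v where "w = [v]" by (metis One_nat_def length_0_conv length_Suc_conv)
        then show ?thesis by (simp add: d \<beta>_def y)
      next
        case False
        then have "\<alpha> w = 0" using \<alpha> by (auto simp: tensor_alg_deg_def)
        then show ?thesis using False by (auto simp: d \<beta>_def split: list.splits)
      qed
    qed
    ultimately show "\<alpha> \<in> coboundaries1 V E \<theta> \<omega>" using \<alpha> by (auto simp: coboundaries1_def)
  qed
qed

lemma cocycles1_iff:
  assumes "finite V" and rep: "sl2_representation \<theta>" and \<omega>: "\<omega> \<in> tuples V"
    and \<alpha>: "\<alpha> \<in> tensor_alg_deg 1 V UNIV"
  shows "\<alpha> \<in> cocycles1 V E \<theta> \<omega> \<longleftrightarrow>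
    (\<forall>u v. {u, v} \<in> E \<longrightarrow> \<theta> (\<omega> u) *v \<alpha> [v] = \<theta> (\<omega> v) *v \<alpha> [u])"
proof -
  have d: "d_omega \<theta> \<omega> \<alpha> w = (case w of [] \<Rightarrow> 0 | v # w' \<Rightarrow> \<theta> (\<omega> v) *v \<alpha> w')" for w
    using rep_zero[OF rep] by (simp add: d_omega_def raag_diff_def conv_one_form)
  have "quadratic V UNIV (d_omega \<theta> \<omega> \<alpha>)"
    unfolding quadratic_def
  proof (intro conjI allI impI)
    fix w assume nz: "d_omega \<theta> \<omega> \<alpha> w \<noteq> 0"
    then obtain u w' where w: "w = u # w'" "\<theta> (\<omega> u) *v \<alpha> w' \<noteq> 0"
      by (auto simp: d split: list.splits)
    then have "\<omega> u \<noteq> 0" "\<alpha> w' \<noteq> 0" using rep_zero[OF rep] by auto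
    then have "u \<in> V" "length w' = 1" "w' \<in> lists V" using \<omega> \<alpha>
      by (auto simp: tuples_def tensor_alg_deg_def tensor_alg_def)
    moreover then obtain v where "w' = [v]" by (metis One_nat_def length_0_conv length_Suc_conv)
    ultimately show "\<exists>u\<in>V. \<exists>v\<in>V. w = [u, v]" using w by auto
  qed simp
  from quadratic_class_eq_0_iff[OF assms(1) vec.vector_space_axioms vec.subspace_UNIV this, of E]
  show ?thesis using \<alpha> by (simp add: cocycles1_def d)
qed

lemma resonance_iff:
  assumes graph: "simplicial_graph V E" and rep: "sl2_representation \<theta>"
  shows "\<omega> \<in> resonance V E \<theta> \<longleftrightarrow> \<omega> \<in> flat_connections V E \<and>
    (\<exists>x. (\<forall>u v. {u, v} \<in> E \<longrightarrow> \<theta> (\<omega> u) *v x v = \<theta> (\<omega> v) *v x u) \<and>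
         (\<nexists>y. \<forall>v\<in>V. x v = \<theta> (\<omega> v) *v y))"
proof (cases "\<omega> \<in> flat_connections V E")
  case True
  have E: "u \<in> V \<and> v \<in> V" if "{u, v} \<in> E" for u v
    using graph that by (auto simp: simplicial_graph_def)
  have fin: "finite V" using graph by (simp add: simplicial_graph_def)
  have \<omega>: "\<omega> \<in> tuples V" using True by (simp add: flat_connections_def)
  let ?T = "tensor_alg_deg 1 V UNIV :: ('a list \<Rightarrow> complex^'b) set"
  let ?Z = "cocycles1 V E \<theta> \<omega>" and ?B = "coboundaries1 V E \<theta> \<omega>"
  note Z = cocycles1_iff[OF fin rep \<omega>, of _ E] and B = coboundaries1_iff[OF rep \<omega>, of _ E]
  have T: "?Z \<subseteq> ?T" "?B \<subseteq> ?T" by (auto simp: cocycles1_def coboundaries1_def)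
  have commute: "\<theta> (\<omega> u) *v (\<theta> (\<omega> v) *v y) = \<theta> (\<omega> v) *v (\<theta> (\<omega> u) *v y)" if "{u, v} \<in> E" for u v y
  proof -
    have sl2: "\<omega> u \<in> sl2" "\<omega> v \<in> sl2" using tuplesD[OF \<omega>] by auto
    have "lie_bracket (\<omega> u) (\<omega> v) = 0"
      using True that flat_connections_iff[OF fin] lie_bracket_eq_0_iff_parallel[OF sl2] by blast
    then have "lie_bracket (\<theta> (\<omega> u)) (\<theta> (\<omega> v)) = 0"
      using rep_bracket[OF rep sl2] rep_zero[OF rep] by simp
    then show ?thesis by (simp add: lie_bracket_def matrix_vector_mul_assoc)
  qed
  have BZ: "?B \<subseteq> ?Z"
  proof
    fix \<alpha> assume \<alpha>: "\<alpha> \<in> ?B"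
    then have \<alpha>T: "\<alpha> \<in> ?T" using T by blast
    then obtain y where "\<And>v. \<alpha> [v] = \<theta> (\<omega> v) *v y" using \<alpha> B[OF \<alpha>T] by auto
    then show "\<alpha> \<in> ?Z" unfolding Z[OF \<alpha>T] using commute by metis
  qed
  have zero: "0 \<in> ?T" by (simp add: tensor_alg_deg_def tensor_alg_def)
  have diff: "\<alpha> - \<beta> \<in> ?T" if "\<alpha> \<in> ?T" "\<beta> \<in> ?T" for \<alpha> \<beta>
  proof -
    have "{w. (\<alpha> - \<beta>) w \<noteq> 0} \<subseteq> {w. \<alpha> w \<noteq> 0} \<union> {w. \<beta> w \<noteq> 0}" by auto
    then have "finite {w. (\<alpha> - \<beta>) w \<noteq> 0}"
      by (rule finite_subset) (use that in \<open>simp add: tensor_alg_deg_def tensor_alg_def\<close>)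
    moreover have "w \<in> lists V \<and> length w = 1" if "(\<alpha> - \<beta>) w \<noteq> 0" for w
    proof -
      have "\<alpha> w \<noteq> 0 \<or> \<beta> w \<noteq> 0" using that by auto
      then show ?thesis using \<open>\<alpha> \<in> ?T\<close> \<open>\<beta> \<in> ?T\<close> by (auto simp: tensor_alg_deg_def tensor_alg_def)
    qed
    ultimately show ?thesis by (simp add: tensor_alg_deg_def tensor_alg_def)
  qed
  have "0 \<in> ?B" using zero by (auto simp: B intro!: exI[of _ 0])
  moreover have "\<alpha> - \<beta> \<in> ?B" if \<alpha>\<beta>: "\<alpha> \<in> ?B" "\<beta> \<in> ?B" for \<alpha> \<beta>
  proof -
    have 1: "\<alpha> \<in> ?T" "\<beta> \<in> ?T" using \<alpha>\<beta> T by auto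
    then obtain y z where "\<And>v. \<alpha> [v] = \<theta> (\<omega> v) *v y" "\<And>v. \<beta> [v] = \<theta> (\<omega> v) *v z"
      using \<alpha>\<beta> B[OF 1(1)] B[OF 1(2)] by auto
    then show ?thesis unfolding B[OF diff[OF 1]]
      by (intro exI[of _ "y - z"]) (simp add: matrix_vector_mult_diff_distrib)
  qed
  ultimately have "\<omega> \<in> resonance V E \<theta> \<longleftrightarrow> \<not> ?Z \<subseteq> ?B"
    using True cohomology1_nonzero_iff[OF BZ] by (simp add: resonance_def)
  also have "\<dots> \<longleftrightarrow> (\<exists>x. (\<forall>u v. {u, v} \<in> E \<longrightarrow> \<theta> (\<omega> u) *v x v = \<theta> (\<omega> v) *v x u) \<and>
         (\<nexists>y. \<forall>v\<in>V. x v = \<theta> (\<omega> v) *v y))" (is "?L \<longleftrightarrow> ?R")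
  proof
    assume ?L
    then obtain \<alpha> where \<alpha>: "\<alpha> \<in> ?Z" "\<alpha> \<notin> ?B" by blast
    then have \<alpha>T: "\<alpha> \<in> ?T" using T by blast
    have "\<alpha> [v] = 0 \<and> \<omega> v = 0" if "v \<notin> V" for v
      using that \<alpha>T \<omega> by (auto simp: tensor_alg_deg_def tensor_alg_def tuples_def)
    then have "\<nexists>y. \<forall>v\<in>V. \<alpha> [v] = \<theta> (\<omega> v) *v y"
      using \<alpha>(2) B[OF \<alpha>T] rep_zero[OF rep] by (metis matrix_vector_mult_0)
    then show ?R using \<alpha>(1) Z[OF \<alpha>T] by (intro exI[of _ "\<lambda>v. \<alpha> [v]"]) simp
  next
    assume ?R
    then obtain x where x: "\<And>u v. {u, v} \<in> E \<Longrightarrow> \<theta> (\<omega> u) *v x v = \<theta> (\<omega> v) *v x u"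
      "\<nexists>y. \<forall>v\<in>V. x v = \<theta> (\<omega> v) *v y" by blast
    define \<alpha> where "\<alpha> w = (case w of [v] \<Rightarrow> if v \<in> V then x v else 0 | _ \<Rightarrow> 0)" for w
    have supp: "\<exists>v\<in>V. w = [v]" if "\<alpha> w \<noteq> 0" for w
      using that by (auto simp: \<alpha>_def split: list.splits if_splits)
    then have "{w. \<alpha> w \<noteq> 0} \<subseteq> (\<lambda>v. [v]) ` V" by blast
    then have "finite {w. \<alpha> w \<noteq> 0}" using fin finite_subset by blast
    then have \<alpha>T: "\<alpha> \<in> ?T" using supp by (fastforce simp: tensor_alg_deg_def tensor_alg_def)
    have "\<alpha> \<in> ?Z" unfolding Z[OF \<alpha>T] using x(1) E by (auto simp: \<alpha>_def)
    moreover have "\<alpha> \<notin> ?B" unfolding B[OF \<alpha>T] using x(2) by (auto simp: \<alpha>_def)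
    ultimately show ?L by blast
  qed
  finally show ?thesis using True by simp
qed (simp add: resonance_def)

section \<open>Closedness and irreducibility of the strata\<close>

lemma zariski_closed_Un:
  assumes "zariski_closed V A" "zariski_closed V B"
  shows "zariski_closed V (A \<union> B)"
proof -
  obtain P Q where P: "P \<subseteq> polynomial_functions" "A = {\<omega> \<in> tuples V. \<forall>p\<in>P. p \<omega> = 0}"
    and Q: "Q \<subseteq> polynomial_functions" "B = {\<omega> \<in> tuples V. \<forall>q\<in>Q. q \<omega> = 0}"
    using assms unfolding zariski_closed_def by blast
  let ?R = "{(\<lambda>\<omega>. p \<omega> * q \<omega>) | p q. p \<in> P \<and> q \<in> Q}"
  have "?R \<subseteq> polynomial_functions"
    using P(1) Q(1) by (blast intro: polynomial_functions.mult)
  moreover have "A \<union> B = {\<omega> \<in> tuples V. \<forall>r\<in>?R. r \<omega> = 0}"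
  proof (intro set_eqI iffI)
    fix \<omega> assume "\<omega> \<in> A \<union> B"
    then show "\<omega> \<in> {\<omega> \<in> tuples V. \<forall>r\<in>?R. r \<omega> = 0}" by (auto simp: P(2) Q(2))
  next
    fix \<omega> assume \<omega>: "\<omega> \<in> {\<omega> \<in> tuples V. \<forall>r\<in>?R. r \<omega> = 0}"
    show "\<omega> \<in> A \<union> B"
    proof (rule ccontr)
      assume "\<omega> \<notin> A \<union> B"
      then obtain p q where "p \<in> P" "q \<in> Q" "p \<omega> \<noteq> 0" "q \<omega> \<noteq> 0"
        using \<omega> by (auto simp: P(2) Q(2))
      moreover from this have "(\<lambda>\<omega>. p \<omega> * q \<omega>) \<in> ?R" by blast
      ultimately show False using \<omega> by fastforce
    qed
  qed
  ultimately show ?thesis unfolding zariski_closed_def by blast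
qed

lemma zariski_closed_empty: "zariski_closed V {}"
  unfolding zariski_closed_def
  by (rule exI[of _ "{\<lambda>\<omega>. 1}"]) (auto intro: polynomial_functions.const)

lemma zariski_closed_UN:
  "finite I \<Longrightarrow> (\<And>i. i \<in> I \<Longrightarrow> zariski_closed V (Z i)) \<Longrightarrow> zariski_closed V (\<Union>i\<in>I. Z i)"
  by (induction I rule: finite_induct) (auto intro: zariski_closed_Un zariski_closed_empty)

lemma irreducible_subset_UN:
  assumes irr: "zariski_irreducible V Y" and "finite I"
    and "\<And>i. i \<in> I \<Longrightarrow> zariski_closed V (Z i)" and "Y \<subseteq> (\<Union>i\<in>I. Z i)"
  shows "\<exists>i\<in>I. Y \<subseteq> Z i"
  using assms(2-)
proof (induction I rule: finite_induct)
  case empty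
  then show ?case using irr by (auto simp: zariski_irreducible_def)
next
  case (insert i I)
  have "zariski_closed V (Z i)" "zariski_closed V (\<Union>i\<in>I. Z i)"
    using insert by (auto intro: zariski_closed_UN)
  moreover have "Y \<subseteq> Z i \<union> (\<Union>i\<in>I. Z i)" using insert.prems(2) by simp
  ultimately have "Y \<subseteq> Z i \<or> Y \<subseteq> (\<Union>i\<in>I. Z i)"
    using irr unfolding zariski_irreducible_def by blast
  then show ?case using insert by auto
qed

text \<open>An irreducible subset of a finite union of closed sets lies in one of them, so the maximal
  closed irreducible subsets are among the members of the union; and no member is absorbed by
  another one.\<close>

lemma irreducible_components_finite_union:
  assumes fin: "finite I"
    and closed: "\<And>i. i \<in> I \<Longrightarrow> zariski_closed V (Z i)"
    and irr: "\<And>i. i \<in> I \<Longrightarrow> zariski_irreducible V (Z i)"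
    and incomparable: "\<And>i j. i \<in> I \<Longrightarrow> j \<in> I \<Longrightarrow> Z i \<subseteq> Z j \<Longrightarrow> i = j"
    and X: "X = (\<Union>i\<in>I. Z i)"
  shows "bij_betw Z I (irreducible_components V X)"
proof (rule bij_betw_imageI)
  show "inj_on Z I" by (rule inj_onI) (use incomparable in blast)
  have inside: "\<exists>i\<in>I. Y \<subseteq> Z i" if "Y \<subseteq> X" "zariski_irreducible V Y" for Y
    by (rule irreducible_subset_UN[OF that(2) fin closed]) (use that(1) X in auto)
  show "Z ` I = irreducible_components V X"
  proof (intro set_eqI iffI)
    fix Y assume "Y \<in> Z ` I"
    then obtain i where i: "i \<in> I" "Y = Z i" by blast
    have "Y' = Z i" if Y': "Z i \<subseteq> Y'" "Y' \<subseteq> X" "zariski_irreducible V Y'" for Y'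
    proof -
      obtain j where j: "j \<in> I" "Y' \<subseteq> Z j" using inside Y' by blast
      then have "i = j" using incomparable i(1) Y'(1) by blast
      then show ?thesis using j Y'(1) by blast
    qed
    then show "Y \<in> irreducible_components V X"
      using i closed[OF i(1)] irr[OF i(1)] X unfolding irreducible_components_def by blast
  next
    fix Y assume Y: "Y \<in> irreducible_components V X"
    then have "Y \<subseteq> X" "zariski_irreducible V Y" by (auto simp: irreducible_components_def)
    then obtain i where i: "i \<in> I" "Y \<subseteq> Z i" using inside by blast
    moreover have "Z i \<subseteq> X" using i X by blast
    ultimately have "Z i = Y"
      using Y closed[OF i(1)] irr[OF i(1)] unfolding irreducible_components_def by blast
    then show "Y \<in> Z ` I" using i by blast
  qed
qed

definition is_poly :: "(complex \<Rightarrow> complex) \<Rightarrow> bool" where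
  "is_poly f \<longleftrightarrow> (\<exists>p. f = poly p)"

lemma is_poly_intros [intro]:
  "is_poly (\<lambda>t. c)" "is_poly (\<lambda>t. t)"
  "is_poly f \<Longrightarrow> is_poly g \<Longrightarrow> is_poly (\<lambda>t. f t + g t)"
  "is_poly f \<Longrightarrow> is_poly g \<Longrightarrow> is_poly (\<lambda>t. f t * g t)"
proof -
  have "(\<lambda>t. c) = poly [:c:]" "(\<lambda>t. t) = poly [:0, 1 :: complex:]" by (simp_all add: fun_eq_iff)
  then show "is_poly (\<lambda>t. c)" "is_poly (\<lambda>t. t)" unfolding is_poly_def by blast+
next
  assume "is_poly f" "is_poly g"
  then obtain p q where "f = poly p" "g = poly q" by (auto simp: is_poly_def)
  then have "(\<lambda>t. f t + g t) = poly (p + q)" "(\<lambda>t. f t * g t) = poly (p * q)" by (simp_all add: fun_eq_iff)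
  then show "is_poly (\<lambda>t. f t + g t)" "is_poly (\<lambda>t. f t * g t)" unfolding is_poly_def by blast+
qed

definition segment_curve :: "complex \<Rightarrow> complex \<Rightarrow> complex \<Rightarrow> complex" where
  "segment_curve a b t = a + t * (b - a)"

lemma segment_curve [simp]: "segment_curve a b 0 = a" "segment_curve a b 1 = b"
  by (simp_all add: segment_curve_def)

lemma is_poly_segment_curve [intro]: "is_poly (segment_curve a b)"
  unfolding segment_curve_def[abs_def] by (intro is_poly_intros)

definition poly_curve :: "(complex \<Rightarrow> complex^2^2) \<Rightarrow> bool" where
  "poly_curve \<gamma> \<longleftrightarrow> (\<forall>i j. is_poly (\<lambda>t. \<gamma> t $ i $ j))"

text \<open>If \<open>p\<close> does not vanish at \<open>\<omega>\<close> and \<open>q\<close> does not vanish at \<open>\<omega>'\<close>, then on a polynomial curve through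
  both points \<open>p\<close> and \<open>q\<close> become nonzero polynomials in one variable, so some point of the curve is
  a zero of neither.\<close>

lemma irreducible_if_poly_curve_connected:
  assumes "Z \<noteq> {}" "Z \<subseteq> tuples V"
    and curve: "\<And>\<omega> \<omega>'. \<omega> \<in> Z \<Longrightarrow> \<omega>' \<in> Z \<Longrightarrow>
      \<exists>\<gamma>. \<gamma> 0 = \<omega> \<and> \<gamma> 1 = \<omega>' \<and> (\<forall>t. \<gamma> t \<in> Z) \<and> (\<forall>v. poly_curve (\<lambda>t. \<gamma> t v))"
  shows "zariski_irreducible V Z"
  unfolding zariski_irreducible_def
proof (intro conjI allI impI)
  fix A B assume AB: "zariski_closed V A \<and> zariski_closed V B \<and> Z \<subseteq> A \<union> B"
  show "Z \<subseteq> A \<or> Z \<subseteq> B"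
  proof (rule ccontr)
    assume "\<not> (Z \<subseteq> A \<or> Z \<subseteq> B)"
    then obtain \<omega> \<omega>' where w: "\<omega> \<in> Z" "\<omega> \<notin> A" "\<omega>' \<in> Z" "\<omega>' \<notin> B" by blast
    obtain P Q where P: "P \<subseteq> polynomial_functions" "A = {\<omega> \<in> tuples V. \<forall>p\<in>P. p \<omega> = 0}"
      and Q: "Q \<subseteq> polynomial_functions" "B = {\<omega> \<in> tuples V. \<forall>q\<in>Q. q \<omega> = 0}"
      using AB unfolding zariski_closed_def by blast
    obtain p q where p: "p \<in> P" "p \<omega> \<noteq> 0" and q: "q \<in> Q" "q \<omega>' \<noteq> 0"
      using w P(2) Q(2) assms(2) by auto
    obtain \<gamma> where \<gamma>: "\<gamma> 0 = \<omega>" "\<gamma> 1 = \<omega>'" "\<And>t. \<gamma> t \<in> Z" "\<And>v. poly_curve (\<lambda>t. \<gamma> t v)"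
      using curve[OF w(1,3)] by blast
    have pull: "is_poly (\<lambda>t. f (\<gamma> t))" if "f \<in> polynomial_functions" for f
      using that
    proof induction
      case (coord v i j)
      then show ?case using \<gamma>(4) by (simp add: poly_curve_def)
    qed auto
    obtain p' q' where p': "(\<lambda>t. p (\<gamma> t)) = poly p'" and q': "(\<lambda>t. q (\<gamma> t)) = poly q'"
      using pull[of p] pull[of q] p(1) q(1) P(1) Q(1) unfolding is_poly_def by blast
    have "poly p' 0 \<noteq> 0" "poly q' 1 \<noteq> 0" using p(2) q(2) \<gamma>(1,2) fun_cong[OF p'] fun_cong[OF q'] by auto
    then have "p' * q' \<noteq> 0" by auto
    then have "finite {t. poly (p' * q') t = 0}" by (rule poly_roots_finite)
    then obtain t where "poly (p' * q') t \<noteq> 0"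
      by (metis (mono_tags, lifting) infinite_UNIV_char_0 ex_new_if_finite mem_Collect_eq)
    then have "p (\<gamma> t) \<noteq> 0" "q (\<gamma> t) \<noteq> 0" using fun_cong[OF p', of t] fun_cong[OF q', of t] by auto
    then have "\<gamma> t \<notin> A \<union> B" using p q P Q by auto
    then show False using AB \<gamma>(3) by blast
  qed
qed (fact assms(1))

lemma zero_in_S_set: "finite V \<Longrightarrow> W \<subseteq> V \<Longrightarrow> (\<lambda>v. 0) \<in> S_set V E W"
  by (auto simp: S_set_iff tuples_def sl2_closed)

lemma parallel_family_scalars:
  assumes "g \<noteq> 0" "\<And>v. v \<in> C \<Longrightarrow> parallel g (\<omega> v)"
  obtains l where "\<And>v. v \<in> C \<Longrightarrow> \<omega> v = mat_scale (l v) g"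
proof -
  have "\<forall>v\<in>C. \<exists>c. \<omega> v = mat_scale c g" using assms parallelD by metis
  then show thesis using that by (metis bchoice)
qed

text \<open>The generator depends only on the component, and it exists also where \<open>\<omega>\<close> vanishes; so
  generators and scalars of two points of \<open>S\<^sub>W\<close> can be interpolated separately.\<close>

lemma S_set_factor:
  assumes "finite V" "W \<subseteq> V" "\<omega> \<in> S_set V E W"
  obtains l G where "\<And>v. G v \<in> sl2" "\<And>u v. (u, v) \<in> connected_in E W \<Longrightarrow> G u = G v"
    "\<And>v. v \<in> W \<Longrightarrow> \<omega> v = mat_scale (l v) (G v)"
proof -
  note S = assms(3)[unfolded S_set_iff[OF assms(1,2)]]
  define N where "N v = {u. (v, u) \<in> connected_in E W \<and> \<omega> u \<noteq> 0}" for v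
  define G where "G v = (if N v = {} then 0 else \<omega> (SOME u. u \<in> N v))" for v
  have G1: "G v \<in> sl2" for v using S tuplesD[of \<omega> V] by (simp add: G_def sl2_closed)
  have "N u = N v" if "(u, v) \<in> connected_in E W" for u v
  proof -
    have "(u, w) \<in> connected_in E W \<longleftrightarrow> (v, w) \<in> connected_in E W" for w
      using connected_in_trans[OF that, of w] connected_in_trans[OF connected_in_sym[OF that], of w] by blast
    then show ?thesis by (simp add: N_def)
  qed
  then have G2: "G u = G v" if "(u, v) \<in> connected_in E W" for u v using that by (simp add: G_def)
  have "\<exists>c. \<omega> v = mat_scale c (G v)" if v: "v \<in> W" for v
  proof (cases "N v = {}")
    case True
    then have "\<omega> v = 0" using connected_in_refl[OF v] by (auto simp: N_def)
    then show ?thesis by (intro exI[of _ 0]) simp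
  next
    case False
    then have "(SOME u. u \<in> N v) \<in> N v" by (simp add: some_in_eq)
    moreover define u where "u = (SOME u. u \<in> N v)"
    moreover have "G v = \<omega> (SOME u. u \<in> N v)" using False by (simp add: G_def)
    ultimately have "G v = \<omega> u" "(v, u) \<in> connected_in E W" "\<omega> u \<noteq> 0"
      by (simp_all add: N_def)
    then have "parallel (\<omega> u) (\<omega> v)" "\<omega> u \<noteq> 0" "G v = \<omega> u" using S parallel_sym by blast+
    then show ?thesis by (metis parallelD)
  qed
  then obtain l where "\<And>v. v \<in> W \<Longrightarrow> \<omega> v = mat_scale (l v) (G v)" by metis
  then show thesis using that G1 G2 by blast
qed

lemma S_set_irreducible:
  assumes "finite V" "W \<subseteq> V"
  shows "zariski_irreducible V (S_set V E W)"
proof (rule irreducible_if_poly_curve_connected)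
  show "S_set V E W \<noteq> {}" using zero_in_S_set[OF assms] by blast
  show "S_set V E W \<subseteq> tuples V" by (auto simp: S_set_def)
  fix \<omega> \<omega>' assume \<omega>: "\<omega> \<in> S_set V E W" and \<omega>': "\<omega>' \<in> S_set V E W"
  obtain l G where G: "\<And>v. G v \<in> sl2" "\<And>u v. (u, v) \<in> connected_in E W \<Longrightarrow> G u = G v"
    "\<And>v. v \<in> W \<Longrightarrow> \<omega> v = mat_scale (l v) (G v)" using S_set_factor[OF assms \<omega>] by metis
  obtain l' G' where G': "\<And>v. G' v \<in> sl2" "\<And>u v. (u, v) \<in> connected_in E W \<Longrightarrow> G' u = G' v"
    "\<And>v. v \<in> W \<Longrightarrow> \<omega>' v = mat_scale (l' v) (G' v)" using S_set_factor[OF assms \<omega>'] by metis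
  define H where "H t v = (\<chi> i j. segment_curve (G v $ i $ j) (G' v $ i $ j) t)" for t v
  define \<gamma> where "\<gamma> t v = (if v \<in> W then mat_scale (segment_curve (l v) (l' v) t) (H t v) else 0)" for t v
  have sl2: "H t v \<in> sl2" for t v
    using G(1)[of v] G'(1)[of v] by (simp add: H_def mem_sl2 segment_curve_def algebra_simps)
  have "H 0 v = G v" "H 1 v = G' v" for v by (simp_all add: H_def vec_eq_iff)
  moreover have "\<omega> v = 0" "\<omega>' v = 0" if "v \<notin> W" for v
    using \<omega> \<omega>' that unfolding S_set_iff[OF assms] by auto
  ultimately have "\<gamma> 0 = \<omega>" "\<gamma> 1 = \<omega>'" using G(3) G'(3) by (auto simp: \<gamma>_def fun_eq_iff)
  moreover have "\<gamma> t \<in> S_set V E W" for t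
    unfolding S_set_iff[OF assms]
  proof (intro conjI)
    show "\<gamma> t \<in> tuples V" using sl2 assms(2) by (auto simp: tuples_def \<gamma>_def sl2_closed)
    have "parallel (\<gamma> t u) (\<gamma> t v)" if "(u, v) \<in> connected_in E W" for u v
      using G(2)[OF that] G'(2)[OF that] by (simp add: \<gamma>_def H_def parallel_multiples)
    then show "\<forall>(u, v)\<in>connected_in E W. parallel (\<gamma> t u) (\<gamma> t v)" by blast
  qed (simp add: \<gamma>_def)
  moreover have "poly_curve (\<lambda>t. \<gamma> t v)" for v
    unfolding poly_curve_def \<gamma>_def H_def by (cases "v \<in> W") (auto intro!: is_poly_intros(1,3,4) is_poly_segment_curve)
  ultimately show "\<exists>\<gamma>. \<gamma> 0 = \<omega> \<and> \<gamma> 1 = \<omega>' \<and> (\<forall>t. \<gamma> t \<in> S_set V E W) \<and> (\<forall>v. poly_curve (\<lambda>t. \<gamma> t v))"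
    by blast
qed

text \<open>On the nilpotent cone the curve is the image of a segment under the parametrization by
  \<open>(p, q)\<close>, whose square roots and sign exist over the complex numbers.\<close>

lemma det_locus_curve_connected:
  assumes rep: "sl2_representation \<theta>" and g: "g \<in> det_locus \<theta>" "g' \<in> det_locus \<theta>"
  shows "\<exists>\<delta>. \<delta> 0 = g \<and> \<delta> 1 = g' \<and> (\<forall>t. \<delta> t \<in> det_locus \<theta>) \<and> poly_curve \<delta>"
  using det_locus_dichotomy[OF rep]
proof
  assume D: "det_locus \<theta> = sl2"
  define \<delta> where "\<delta> t = (\<chi> i j. segment_curve (g $ i $ j) (g' $ i $ j) t)" for t
  have "\<delta> 0 = g" "\<delta> 1 = g'" by (simp_all add: \<delta>_def vec_eq_iff)
  moreover have "\<delta> t \<in> det_locus \<theta>" for t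
    using g unfolding D by (simp add: \<delta>_def mem_sl2 segment_curve_def algebra_simps)
  moreover have "poly_curve \<delta>" unfolding poly_curve_def \<delta>_def by (auto intro: is_poly_segment_curve)
  ultimately show ?thesis by blast
next
  assume D: "det_locus \<theta> = {g \<in> sl2. det g = 0}"
  have param: "\<exists>p q. h = sl2_matrix (p * q) (p * p) (- (q * q))" if h: "h \<in> det_locus \<theta>" for h
  proof -
    obtain a b c where abc: "h = sl2_matrix a b c" using h D sl2_cases by blast
    have a2: "a * a = b * (- c)" using h by (simp add: D abc det_sl2_matrix add_eq_0_iff eq_neg_iff_add_eq_0 eq_diff_eq)
    define p q where "p = csqrt b" and "q = csqrt (- c)"
    have pq: "p * p = b" "q * q = - c" by (simp_all add: p_def q_def power2_eq_square[symmetric])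
    have "(a - p * q) * (a + p * q) = a * a - (p * p) * (q * q)" by (simp add: algebra_simps)
    also have "\<dots> = 0" by (simp add: a2 pq)
    finally have "a = p * q \<or> a = p * (- q)" by (auto simp: add_eq_0_iff2)
    then show ?thesis
    proof
      assume "a = p * q"
      then show ?thesis using pq by (intro exI[of _ p] exI[of _ q]) (simp add: abc)
    next
      assume "a = p * (- q)"
      then show ?thesis using pq by (intro exI[of _ p] exI[of _ "- q"]) (simp add: abc)
    qed
  qed
  obtain p q where pq: "g = sl2_matrix (p * q) (p * p) (- (q * q))" using param g(1) by blast
  obtain p' q' where pq': "g' = sl2_matrix (p' * q') (p' * p') (- (q' * q'))" using param g(2) by blast
  let ?p = "segment_curve p p'" and ?q = "segment_curve q q'"
  define \<delta> where "\<delta> t = sl2_matrix (?p t * ?q t) (?p t * ?p t) ((-1) * (?q t * ?q t))" for t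
  have "\<delta> 0 = g" "\<delta> 1 = g'" by (simp_all add: \<delta>_def pq pq')
  moreover have "\<delta> t \<in> det_locus \<theta>" for t by (simp add: D \<delta>_def det_sl2_matrix)
  moreover have "poly_curve \<delta>"
  proof -
    have "is_poly (\<lambda>t. ?p t * ?q t)" "is_poly (\<lambda>t. ?p t * ?p t)" "is_poly (\<lambda>t. (-1) * (?q t * ?q t))"
      "is_poly (\<lambda>t. (-1) * (?p t * ?q t))"
      by (intro is_poly_intros(1,4) is_poly_segment_curve)+
    then show ?thesis by (simp add: poly_curve_def forall_2 \<delta>_def)
  qed
  ultimately show ?thesis by blast
qed

lemma zero_in_det_locus: "sl2_representation \<theta> \<Longrightarrow> 0 \<in> det_locus \<theta>"
  by (simp add: det_locus_def sl2_closed rep_zero det_zero_matrix)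

lemma det_locus_scale:
  assumes "sl2_representation \<theta>" "g \<in> det_locus \<theta>" shows "mat_scale c g \<in> det_locus \<theta>"
proof (cases "c = 0")
  case True
  then show ?thesis using zero_in_det_locus[OF assms(1)] by simp
next
  case False
  then show ?thesis using assms
    by (simp add: det_locus_def sl2_closed rep_scale det_mat_scale_eq_0_iff)
qed

lemma P_set_iff:
  "\<omega> \<in> P_set V \<theta> W \<longleftrightarrow> \<omega> \<in> tuples V \<and> (\<forall>v. v \<notin> W \<longrightarrow> \<omega> v = 0) \<and>
     (\<exists>l. \<exists>g\<in>det_locus \<theta>. \<forall>v\<in>W. \<omega> v = mat_scale (l v) g)"
  by (auto simp: P_set_def tuples_def)

lemma P_set_irreducible:
  assumes rep: "sl2_representation \<theta>" and W: "W \<subseteq> V"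
  shows "zariski_irreducible V (P_set V \<theta> W)"
proof (rule irreducible_if_poly_curve_connected)
  have "(\<lambda>v. 0) \<in> P_set V \<theta> W"
    using zero_in_det_locus[OF rep] unfolding P_set_iff
    by (auto simp: tuples_def sl2_closed intro!: bexI[of _ 0])
  then show "P_set V \<theta> W \<noteq> {}" by blast
  show "P_set V \<theta> W \<subseteq> tuples V" by (auto simp: P_set_def)
  fix \<omega> \<omega>' assume \<omega>: "\<omega> \<in> P_set V \<theta> W" and \<omega>': "\<omega>' \<in> P_set V \<theta> W"
  obtain l g where g: "g \<in> det_locus \<theta>" "\<And>v. v \<in> W \<Longrightarrow> \<omega> v = mat_scale (l v) g"
    using \<omega> unfolding P_set_iff by blast
  obtain l' g' where g': "g' \<in> det_locus \<theta>" "\<And>v. v \<in> W \<Longrightarrow> \<omega>' v = mat_scale (l' v) g'"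
    using \<omega>' unfolding P_set_iff by blast
  obtain \<delta> where \<delta>: "\<delta> 0 = g" "\<delta> 1 = g'" "\<And>t. \<delta> t \<in> det_locus \<theta>" "poly_curve \<delta>"
    using det_locus_curve_connected[OF rep g(1) g'(1)] by blast
  define \<gamma> where "\<gamma> t v = (if v \<in> W then mat_scale (segment_curve (l v) (l' v) t) (\<delta> t) else 0)" for t v
  have "\<omega> v = 0" "\<omega>' v = 0" if "v \<notin> W" for v
    using \<omega> \<omega>' that unfolding P_set_iff by auto
  then have "\<gamma> 0 = \<omega>" "\<gamma> 1 = \<omega>'" using g(2) g'(2) \<delta>(1,2) by (auto simp: \<gamma>_def fun_eq_iff)
  moreover have "\<gamma> t \<in> P_set V \<theta> W" for t
    unfolding P_set_iff
  proof (intro conjI)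
    have "\<delta> t \<in> sl2" using \<delta>(3) by (simp add: det_locus_def)
    then show "\<gamma> t \<in> tuples V" using W by (auto simp: tuples_def \<gamma>_def sl2_closed)
    show "\<exists>l. \<exists>g\<in>det_locus \<theta>. \<forall>v\<in>W. \<gamma> t v = mat_scale (l v) g"
      by (intro exI[of _ "\<lambda>v. segment_curve (l v) (l' v) t"] bexI[OF _ \<delta>(3)[of t]]) (simp add: \<gamma>_def)
  qed (simp add: \<gamma>_def)
  moreover have "poly_curve (\<lambda>t. \<gamma> t v)" for v
    using \<delta>(4) unfolding poly_curve_def \<gamma>_def
    by (cases "v \<in> W") (auto intro!: is_poly_intros(1,4) is_poly_segment_curve)
  ultimately show "\<exists>\<gamma>. \<gamma> 0 = \<omega> \<and> \<gamma> 1 = \<omega>' \<and> (\<forall>t. \<gamma> t \<in> P_set V \<theta> W) \<and> (\<forall>v. poly_curve (\<lambda>t. \<gamma> t v))"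
    by blast
qed

lemma polynomial_diff:
  assumes "p \<in> polynomial_functions" "q \<in> polynomial_functions"
  shows "(\<lambda>\<omega>. p \<omega> - q \<omega>) \<in> polynomial_functions"
  using polynomial_functions.add[OF assms(1) polynomial_functions.mult[OF polynomial_functions.const[of "-1"] assms(2)]]
  by simp

lemma zariski_closed_Collect:
  assumes "\<And>x. x \<in> I \<Longrightarrow> f x \<in> polynomial_functions"
  shows "zariski_closed V {\<omega> \<in> tuples V. \<forall>x\<in>I. f x \<omega> = 0}"
  unfolding zariski_closed_def using assms by (intro exI[of _ "f ` I"]) auto

lemma zariski_closed_Int:
  assumes "zariski_closed V A" "zariski_closed V B"
  shows "zariski_closed V (A \<inter> B)"
proof -
  obtain P Q where "P \<subseteq> polynomial_functions" "A = {\<omega> \<in> tuples V. \<forall>p\<in>P. p \<omega> = 0}"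
    and "Q \<subseteq> polynomial_functions" "B = {\<omega> \<in> tuples V. \<forall>q\<in>Q. q \<omega> = 0}"
    using assms unfolding zariski_closed_def by blast
  then show ?thesis unfolding zariski_closed_def by (intro exI[of _ "P \<union> Q"]) auto
qed

lemma S_set_closed:
  assumes "finite V" "W \<subseteq> V"
  shows "zariski_closed V (S_set V E W)"
proof -
  let ?f = "\<lambda>(v, i, j) \<omega>. \<omega> v $ i $ j :: complex"
  let ?m = "\<lambda>((u, v), i, j, k, l) \<omega>. \<omega> u $ i $ j * \<omega> v $ k $ l - \<omega> u $ k $ l * \<omega> v $ i $ j :: complex"
  have "zariski_closed V ({\<omega> \<in> tuples V. \<forall>x\<in>(- W) \<times> UNIV. ?f x \<omega> = 0} \<inter>
      {\<omega> \<in> tuples V. \<forall>x\<in>connected_in E W \<times> UNIV. ?m x \<omega> = 0})"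
  proof (intro zariski_closed_Int zariski_closed_Collect)
    show "?f x \<in> polynomial_functions" for x
      by (cases x) (simp add: polynomial_functions.coord)
    show "?m x \<in> polynomial_functions" for x
      by (cases x) (auto intro!: polynomial_functions.coord polynomial_functions.mult polynomial_diff)
  qed
  also have "{\<omega> \<in> tuples V. \<forall>x\<in>(- W) \<times> UNIV. ?f x \<omega> = 0} \<inter>
      {\<omega> \<in> tuples V. \<forall>x\<in>connected_in E W \<times> UNIV. ?m x \<omega> = 0} = S_set V E W"
  proof (rule set_eqI)
    fix \<omega> :: "'a \<Rightarrow> complex^2^2"
    have "(\<forall>x\<in>(- W) \<times> UNIV. ?f x \<omega> = 0) \<longleftrightarrow> (\<forall>v. v \<notin> W \<longrightarrow> \<omega> v = 0)"
      by (simp add: vec_eq_iff Ball_def)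
    moreover have "(\<forall>x\<in>connected_in E W \<times> UNIV. ?m x \<omega> = 0) \<longleftrightarrow>
        (\<forall>(u, v)\<in>connected_in E W. parallel (\<omega> u) (\<omega> v))"
      by (simp add: parallel_def Ball_def)
    ultimately show "\<omega> \<in> {\<omega> \<in> tuples V. \<forall>x\<in>(- W) \<times> UNIV. ?f x \<omega> = 0} \<inter>
      {\<omega> \<in> tuples V. \<forall>x\<in>connected_in E W \<times> UNIV. ?m x \<omega> = 0} \<longleftrightarrow> \<omega> \<in> S_set V E W"
      unfolding S_set_iff[OF assms] Int_iff mem_Collect_eq by blast
  qed
  finally show ?thesis .
qed

text \<open>This form of \<open>P\<^sub>W\<close> is free of the existential quantifiers over scalars and generator, hence
  given by equations. The zero tuple fits because \<open>\<theta> 0 = 0\<close> is singular.\<close>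

lemma P_set_eq:
  assumes fin: "finite V" "W \<subseteq> V" and rep: "sl2_representation \<theta>" and c: "num_components E W = 1"
  shows "P_set V \<theta> W = S_set V E W \<inter> {\<omega> \<in> tuples V. \<forall>v\<in>W. \<omega> v \<in> det_locus \<theta>}"
proof -
  have "finite W" using fin finite_subset by blast
  then have conn: "(u, v) \<in> connected_in E W \<longleftrightarrow> u \<in> W \<and> v \<in> W" for u v
    using c num_components_eq_1_iff connected_in_subset by metis
  show ?thesis
  proof (intro set_eqI iffI)
    fix \<omega> assume "\<omega> \<in> P_set V \<theta> W"
    then obtain l g where \<omega>: "\<omega> \<in> tuples V" "\<forall>v. v \<notin> W \<longrightarrow> \<omega> v = 0"
      and g: "g \<in> det_locus \<theta>" "\<And>v. v \<in> W \<Longrightarrow> \<omega> v = mat_scale (l v) g"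
      unfolding P_set_iff by blast
    have "parallel (\<omega> u) (\<omega> v)" if "(u, v) \<in> connected_in E W" for u v
      using that g(2) by (simp add: conn parallel_multiples)
    then show "\<omega> \<in> S_set V E W \<inter> {\<omega> \<in> tuples V. \<forall>v\<in>W. \<omega> v \<in> det_locus \<theta>}"
      using \<omega> g det_locus_scale[OF rep g(1)] unfolding Int_iff S_set_iff[OF fin] by auto
  next
    fix \<omega> assume \<omega>: "\<omega> \<in> S_set V E W \<inter> {\<omega> \<in> tuples V. \<forall>v\<in>W. \<omega> v \<in> det_locus \<theta>}"
    have "\<exists>l. \<exists>g\<in>det_locus \<theta>. \<forall>v\<in>W. \<omega> v = mat_scale (l v) g"
    proof (cases "\<exists>a\<in>W. \<omega> a \<noteq> 0")
      case True
      then obtain a where a: "a \<in> W" "\<omega> a \<noteq> 0" by blast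
      then have "parallel (\<omega> a) (\<omega> v)" if "v \<in> W" for v
        using \<omega> that conn unfolding Int_iff S_set_iff[OF fin] by blast
      then obtain l where "\<And>v. v \<in> W \<Longrightarrow> \<omega> v = mat_scale (l v) (\<omega> a)"
        using parallel_family_scalars[OF a(2), of W \<omega>] by blast
      then show ?thesis using \<omega> a(1) by blast
    next
      case False
      then show ?thesis using zero_in_det_locus[OF rep] by (intro exI bexI[of _ 0]) auto
    qed
    then show "\<omega> \<in> P_set V \<theta> W" using \<omega> unfolding P_set_iff Int_iff S_set_iff[OF fin] by blast
  qed
qed

lemma P_set_closed:
  assumes fin: "finite V" "W \<subseteq> V" and rep: "sl2_representation \<theta>" and c: "num_components E W = 1"
  shows "zariski_closed V (P_set V \<theta> W)"
  unfolding P_set_eq[OF assms]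
proof (rule zariski_closed_Int)
  show "zariski_closed V (S_set V E W)" by (rule S_set_closed[OF fin])
  show "zariski_closed V {\<omega> \<in> tuples V. \<forall>v\<in>W. \<omega> v \<in> det_locus \<theta>}"
    using det_locus_dichotomy[OF rep]
  proof
    assume "det_locus \<theta> = sl2"
    then have "{\<omega> \<in> tuples V. \<forall>v\<in>W. \<omega> v \<in> det_locus \<theta>} = {\<omega> \<in> tuples V. \<forall>p\<in>{}. p \<omega> = 0}"
      using tuplesD by auto
    then show ?thesis unfolding zariski_closed_def by blast
  next
    assume D: "det_locus \<theta> = {g \<in> sl2. det g = 0}"
    have eq: "\<omega> v $ 1 $ 1 * \<omega> v $ 2 $ 2 - \<omega> v $ 1 $ 2 * \<omega> v $ 2 $ 1 = 0 \<longleftrightarrow> \<omega> v \<in> det_locus \<theta>"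
      if "\<omega> \<in> tuples V" for \<omega> v
      using tuplesD[OF that, of v] by (simp add: D det_2)
    have "zariski_closed V {\<omega> \<in> tuples V. \<forall>v\<in>W. \<omega> v $ 1 $ 1 * \<omega> v $ 2 $ 2 - \<omega> v $ 1 $ 2 * \<omega> v $ 2 $ 1 = 0}"
      by (intro zariski_closed_Collect polynomial_diff polynomial_functions.coord polynomial_functions.mult)
    also have "{\<omega> \<in> tuples V. \<forall>v\<in>W. \<omega> v $ 1 $ 1 * \<omega> v $ 2 $ 2 - \<omega> v $ 1 $ 2 * \<omega> v $ 2 $ 1 = 0}
        = {\<omega> \<in> tuples V. \<forall>v\<in>W. \<omega> v \<in> det_locus \<theta>}"
      by (intro Collect_cong conj_cong ball_cong refl eq)
    finally show ?thesis .
  qed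
qed

section \<open>The decompositions\<close>

lemma S_set_subset_flat:
  assumes "finite V" "W \<subseteq> V" shows "S_set V E W \<subseteq> flat_connections V E"
proof
  fix \<omega> assume \<omega>: "\<omega> \<in> S_set V E W"
  have "parallel (\<omega> u) (\<omega> v)" if "{u, v} \<in> E" for u v
  proof (cases "u \<in> W \<and> v \<in> W")
    case True
    then have "(u, v) \<in> connected_in E W" using that connected_in_edge by metis
    then show ?thesis using \<omega> unfolding S_set_iff[OF assms] by blast
  next
    case False
    then have "\<omega> u = 0 \<or> \<omega> v = 0" using \<omega> unfolding S_set_iff[OF assms] by blast
    then show ?thesis by auto
  qed
  then show "\<omega> \<in> flat_connections V E"
    using \<omega> unfolding S_set_iff[OF assms] flat_connections_iff[OF assms(1)] by blast
qed

lemma support_subset: "\<omega> \<in> tuples V \<Longrightarrow> {v. \<omega> v \<noteq> 0} \<subseteq> V"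
  by (auto simp: tuples_def)

lemma flat_in_S_set_support:
  assumes "finite V" "\<omega> \<in> flat_connections V E"
  shows "\<omega> \<in> S_set V E {v. \<omega> v \<noteq> 0}"
proof -
  let ?W = "{v. \<omega> v \<noteq> 0}"
  note flat = assms(2)[unfolded flat_connections_iff[OF assms(1)]]
  have W: "?W \<subseteq> V" using flat support_subset by blast
  have "parallel (\<omega> u) (\<omega> v)" if "(u, v) \<in> connected_in E ?W" for u v
    using that
  proof (induction rule: connected_in_induct)
    case base
    then show ?case by (rule parallel_refl)
  next
    case (step x y)
    then show ?case using flat parallel_trans[of "\<omega> u" "\<omega> x" "\<omega> y"] by blast
  qed
  then show ?thesis using flat unfolding S_set_iff[OF assms(1) W] by blast
qed

lemma flat_connections_decomposition:
  assumes "finite V"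
  shows "flat_connections V E = (\<Union>W \<in> {W. preceq_maximal V E W}. S_set V E W)"
proof (intro subset_antisym subsetI)
  fix \<omega> assume \<omega>: "\<omega> \<in> flat_connections V E"
  have "{v. \<omega> v \<noteq> 0} \<subseteq> V" using \<omega> support_subset by (auto simp: flat_connections_def)
  then obtain W' where W': "sub_preceq E {v. \<omega> v \<noteq> 0} W'" "preceq_maximal V E W'"
    using ex_maximal_above[OF assms, of "{v. \<omega> v \<noteq> 0}" "\<lambda>_. True"] by blast
  then have "W' \<subseteq> V" by (simp add: preceq_maximal_def)
  from S_set_mono[OF assms this W'(1)] flat_in_S_set_support[OF assms \<omega>] W'(2)
  show "\<omega> \<in> (\<Union>W \<in> {W. preceq_maximal V E W}. S_set V E W)" by blast
next
  fix \<omega> assume "\<omega> \<in> (\<Union>W \<in> {W. preceq_maximal V E W}. S_set V E W)"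
  then show "\<omega> \<in> flat_connections V E"
    using S_set_subset_flat[OF assms] by (auto simp: preceq_maximal_def)
qed

text \<open>When \<open>\<omega>\<close> vanishes on the component of \<open>a\<close>, the generator is 0 but the scalars may still be
  chosen nonzero. This degenerate choice makes the argument for resonance uniform on \<open>S\<^sub>W\<close>.\<close>

lemma component_generator:
  assumes "finite V" "W \<subseteq> V" "\<omega> \<in> S_set V E W" "a \<in> W"
  shows "\<exists>g l. (\<forall>v. (a, v) \<in> connected_in E W \<longrightarrow> \<omega> v = mat_scale (l v) g) \<and>
    (\<exists>v. (a, v) \<in> connected_in E W \<and> l v \<noteq> 0) \<and>
    (g = 0 \<or> (\<exists>v. (a, v) \<in> connected_in E W \<and> g = \<omega> v))"
proof -
  let ?C = "{v. (a, v) \<in> connected_in E W}"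
  have a: "a \<in> ?C" using connected_in_refl[OF assms(4)] by simp
  show ?thesis
  proof (cases "\<exists>u\<in>?C. \<omega> u \<noteq> 0")
    case True
    then obtain u where u: "u \<in> ?C" "\<omega> u \<noteq> 0" by blast
    have "parallel (\<omega> u) (\<omega> v)" if "v \<in> ?C" for v
    proof -
      have "(u, v) \<in> connected_in E W"
        using u(1) that connected_in_sym[of a u E W] connected_in_trans[of u a E W v] by simp
      then show ?thesis using assms(3) unfolding S_set_iff[OF assms(1,2)] by blast
    qed
    then obtain l where l: "\<And>v. v \<in> ?C \<Longrightarrow> \<omega> v = mat_scale (l v) (\<omega> u)"
      using parallel_family_scalars[OF u(2), of ?C \<omega>] by blast
    moreover have "l u \<noteq> 0" using l[OF u(1)] u(2) by auto
    ultimately show ?thesis using u(1) by (intro exI[of _ "\<omega> u"] exI[of _ l]) blast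
  next
    case False
    then show ?thesis using a by (intro exI[of _ 0] exI[of _ "\<lambda>_. 1"]) auto
  qed
qed

text \<open>On an edge inside the component both sides are \<open>\<lambda>\<^sub>u \<lambda>\<^sub>v \<theta> g z\<close>. An edge that leaves the component
  also leaves \<open>W\<close>, where \<open>\<omega>\<close> is zero.\<close>

lemma component_cocycle:
  assumes fin: "finite V" "W \<subseteq> V" and rep: "sl2_representation \<theta>" and \<omega>: "\<omega> \<in> S_set V E W"
    and g: "\<And>v. (a, v) \<in> connected_in E W \<Longrightarrow> \<omega> v = mat_scale (l v) g" "g \<in> sl2"
    and x: "x = (\<lambda>v. if (a, v) \<in> connected_in E W then l v *s z else 0)"
    and e: "{u, v} \<in> E"
  shows "\<theta> (\<omega> u) *v x v = \<theta> (\<omega> v) *v x u"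
proof -
  have outside: "\<theta> (\<omega> v) *v x u = 0" if "{u, v} \<in> E" "(a, u) \<in> connected_in E W" "(a, v) \<notin> connected_in E W" for u v
  proof -
    have "v \<notin> W"
    proof
      assume "v \<in> W"
      then have "(u, v) \<in> connected_in E W"
        using that connected_in_edge connected_in_subset by metis
      then show False using that connected_in_trans by metis
    qed
    then have "\<omega> v = 0" using \<omega> unfolding S_set_iff[OF fin] by blast
    then show ?thesis by (simp add: rep_zero[OF rep])
  qed
  show ?thesis
  proof (cases "(a, u) \<in> connected_in E W"; cases "(a, v) \<in> connected_in E W")
    assume "(a, u) \<in> connected_in E W" "(a, v) \<in> connected_in E W"
    then show ?thesis
      by (simp add: x g rep_scale[OF rep] mat_scale_mult_vec vector_scalar_commute mult.commute)
  next
    assume c: "(a, u) \<in> connected_in E W" "(a, v) \<notin> connected_in E W"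
    then have "x v = 0" by (simp add: x)
    then show ?thesis using outside[OF e c] by simp
  next
    assume c: "(a, u) \<notin> connected_in E W" "(a, v) \<in> connected_in E W"
    then have "x u = 0" by (simp add: x)
    moreover have "{v, u} \<in> E" using e by (simp add: insert_commute)
    ultimately show ?thesis using outside[of v u] c by simp
  next
    assume "(a, u) \<notin> connected_in E W" "(a, v) \<notin> connected_in E W"
    then show ?thesis by (simp add: x)
  qed
qed

text \<open>Vanishing of the cohomology turns the cocycle of the component into the coboundary of some
  \<open>y\<close>, and a vertex with nonzero scalar yields \<open>\<theta> g y = z\<close>.\<close>

lemma not_resonant_component:
  assumes graph: "simplicial_graph V E" and W: "W \<subseteq> V" and rep: "sl2_representation \<theta>"
    and \<omega>: "\<omega> \<in> S_set V E W" "\<omega> \<notin> resonance V E \<theta>"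
    and g: "\<And>v. (a, v) \<in> connected_in E W \<Longrightarrow> \<omega> v = mat_scale (l v) g" "g \<in> sl2"
      "\<exists>v. (a, v) \<in> connected_in E W \<and> l v \<noteq> 0"
  shows "\<exists>y. \<theta> g *v y = z \<and> (\<forall>v\<in>V. (a, v) \<notin> connected_in E W \<longrightarrow> \<theta> (\<omega> v) *v y = 0)"
proof -
  have fin: "finite V" using graph by (simp add: simplicial_graph_def)
  define x where "x = (\<lambda>v. if (a, v) \<in> connected_in E W then l v *s z else 0)"
  have cocycle: "\<theta> (\<omega> u) *v x v = \<theta> (\<omega> v) *v x u" if "{u, v} \<in> E" for u v
    by (rule component_cocycle[OF fin W rep \<omega>(1) g(1,2) x_def that])
  have "\<omega> \<in> flat_connections V E" using S_set_subset_flat[OF fin W] \<omega>(1) by blast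
  then obtain y where y: "\<And>v. v \<in> V \<Longrightarrow> x v = \<theta> (\<omega> v) *v y"
    using \<omega>(2) cocycle resonance_iff[OF graph rep, of \<omega>] by metis
  obtain v where v: "(a, v) \<in> connected_in E W" "l v \<noteq> 0" using g(3) by blast
  then have "v \<in> V" using connected_in_subset W by fast
  then have "l v *s z = l v *s (\<theta> g *v y)"
    using y[of v] v g(1)[OF v(1)] by (simp add: x_def rep_scale[OF rep g(2)] mat_scale_mult_vec)
  then have "\<theta> g *v y = z" using v(2) by simp
  moreover have "\<theta> (\<omega> v) *v y = 0" if "v \<in> V" "(a, v) \<notin> connected_in E W" for v
    using y[OF that(1)] that(2) by (simp add: x_def)
  ultimately show ?thesis by blast
qed

text \<open>Let \<open>g\<close> and \<open>h\<close> be the generators on two components. If the cohomology vanished, \<open>\<theta> g\<close> would map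
  the kernel of \<open>\<theta> h\<close> onto the whole space, so \<open>\<theta> h = 0\<close>; but \<open>\<theta> h\<close> would be onto as well.\<close>

lemma S_set_disconnected_resonant:
  assumes graph: "simplicial_graph V E" and W: "W \<subseteq> V" and rep: "sl2_representation \<theta>"
    and c: "num_components E W > 1"
  shows "S_set V E W \<subseteq> resonance V E \<theta>"
proof (rule ccontr)
  assume "\<not> S_set V E W \<subseteq> resonance V E \<theta>"
  then obtain \<omega> where \<omega>: "\<omega> \<in> S_set V E W" "\<omega> \<notin> resonance V E \<theta>" by blast
  have fin: "finite V" "finite W"
    using graph finite_subset[OF W] by (simp_all add: simplicial_graph_def)
  have "\<omega> \<in> tuples V" using \<omega>(1) unfolding S_set_iff[OF fin(1) W] by blast
  then have sl2: "\<omega> v \<in> sl2" for v by (rule tuplesD)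
  obtain a b where ab: "a \<in> W" "b \<in> W" "(a, b) \<notin> connected_in E W"
    using c num_components_gt_1_iff[OF fin(2)] by blast
  obtain g l where g': "\<forall>v. (a, v) \<in> connected_in E W \<longrightarrow> \<omega> v = mat_scale (l v) g"
    "\<exists>v. (a, v) \<in> connected_in E W \<and> l v \<noteq> 0" "g = 0 \<or> (\<exists>v. (a, v) \<in> connected_in E W \<and> g = \<omega> v)"
    using component_generator[OF fin(1) W \<omega>(1) ab(1)] by blast
  note g = g'(1)[rule_format] g'(2,3)
  obtain h m where h': "\<forall>v. (b, v) \<in> connected_in E W \<longrightarrow> \<omega> v = mat_scale (m v) h"
    "\<exists>v. (b, v) \<in> connected_in E W \<and> m v \<noteq> 0" "h = 0 \<or> (\<exists>v. (b, v) \<in> connected_in E W \<and> h = \<omega> v)"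
    using component_generator[OF fin(1) W \<omega>(1) ab(2)] by blast
  note h = h'(1)[rule_format] h'(2,3)
  have gh: "g \<in> sl2" "h \<in> sl2" using g(3) h(3) sl2 sl2_closed(1) by auto
  note A = not_resonant_component[OF graph W rep \<omega> g(1) gh(1) g(2)]
    and B = not_resonant_component[OF graph W rep \<omega> h(1) gh(2) h(2)]
  obtain v where v: "(b, v) \<in> connected_in E W" "m v \<noteq> 0" using h(2) by blast
  have v': "v \<in> V" "(a, v) \<notin> connected_in E W"
    using v(1) ab(3) W connected_in_subset connected_in_sym connected_in_trans by (fast, metis)
  have kerh: "\<theta> h *v y = 0" if "\<theta> (\<omega> v) *v y = 0" for y
    using that v(2) h(1)[OF v(1)] by (simp add: rep_scale[OF rep gh(2)] mat_scale_mult_vec)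
  have "\<exists>y. \<theta> g *v y = z" for z using A[of z] by blast
  then have "det (\<theta> g) \<noteq> 0" by (rule surj_imp_det_nz)
  then have inj: "y = y'" if "\<theta> g *v y = \<theta> g *v y'" for y y'
    using that det_eq_0_iff_kernel[of "\<theta> g"]
    by (metis eq_iff_diff_eq_0 matrix_vector_mult_diff_distrib)
  define z :: "complex^'b" where "z = vec 1"
  have "z \<noteq> 0" by (simp add: z_def vec_eq_iff)
  obtain y0 where y0: "\<theta> h *v y0 = z" using B[of z] by blast
  obtain y where y: "\<theta> g *v y = \<theta> g *v y0" "\<theta> (\<omega> v) *v y = 0" using A[of "\<theta> g *v y0"] v' by blast
  then have "\<theta> h *v y0 = 0" using inj kerh by metis
  then show False using y0 \<open>z \<noteq> 0\<close> by simp
qed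

lemma P_set_resonant:
  assumes graph: "simplicial_graph V E" and W: "W \<subseteq> V" and rep: "sl2_representation \<theta>"
    and c: "num_components E W = 1"
  shows "P_set V \<theta> W \<subseteq> resonance V E \<theta>"
proof (rule ccontr)
  assume "\<not> P_set V \<theta> W \<subseteq> resonance V E \<theta>"
  then obtain \<omega> where \<omega>: "\<omega> \<in> P_set V \<theta> W" "\<omega> \<notin> resonance V E \<theta>" by blast
  have fin: "finite V" "finite W"
    using graph finite_subset[OF W] by (simp_all add: simplicial_graph_def)
  have S: "\<omega> \<in> S_set V E W" and loc: "\<And>v. v \<in> W \<Longrightarrow> \<omega> v \<in> det_locus \<theta>"
    using \<omega>(1) P_set_eq[OF fin(1) W rep c] by auto
  obtain a where a: "a \<in> W" using c num_components_eq_1_iff[OF fin(2)] by blast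
  obtain g l where g': "\<forall>v. (a, v) \<in> connected_in E W \<longrightarrow> \<omega> v = mat_scale (l v) g"
    "\<exists>v. (a, v) \<in> connected_in E W \<and> l v \<noteq> 0" "g = 0 \<or> (\<exists>v. (a, v) \<in> connected_in E W \<and> g = \<omega> v)"
    using component_generator[OF fin(1) W S a] by blast
  note g = g'(1)[rule_format] g'(2,3)
  have gD: "g \<in> det_locus \<theta>"
    using g(3) loc connected_in_subset zero_in_det_locus[OF rep] by metis
  then have "g \<in> sl2" by (simp add: det_locus_def)
  then have "\<exists>y. \<theta> g *v y = z" for z
    using not_resonant_component[OF graph W rep S \<omega>(2) g(1) _ g(2)] by blast
  then have "det (\<theta> g) \<noteq> 0" by (rule surj_imp_det_nz)
  then show False using gD by (simp add: det_locus_def)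
qed

text \<open>The main case is a connected support with \<open>\<theta> \<omega>\<^sub>a\<close> invertible. There a cocycle is
  \<open>\<lambda>\<^sub>v z\<close> on the support and 0 at every other vertex with a neighbour in the support, so a cocycle
  that is no coboundary forces a vertex isolated from the support.\<close>

lemma resonant_cases:
  assumes graph: "simplicial_graph V E" and rep: "sl2_representation \<theta>"
    and \<omega>: "\<omega> \<in> resonance V E \<theta>"
  shows "(\<exists>W\<subseteq>V. num_components E W = 1 \<and> \<omega> \<in> P_set V \<theta> W) \<or>
    (\<exists>W\<subseteq>V. num_components E W > 1 \<and> \<omega> \<in> S_set V E W)"
proof -
  have fin: "finite V" using graph by (simp add: simplicial_graph_def)
  have flat: "\<omega> \<in> flat_connections V E" using \<omega> by (simp add: resonance_def)
  then have tup: "\<omega> \<in> tuples V" by (simp add: flat_connections_def)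
  obtain x where x: "\<And>u v. {u, v} \<in> E \<Longrightarrow> \<theta> (\<omega> u) *v x v = \<theta> (\<omega> v) *v x u"
    "\<nexists>y. \<forall>v\<in>V. x v = \<theta> (\<omega> v) *v y"
    using \<omega> resonance_iff[OF graph rep, of \<omega>] by blast
  define W where "W = {v. \<omega> v \<noteq> 0}"
  have W: "W \<subseteq> V" using support_subset[OF tup] by (simp add: W_def)
  have finW: "finite W" using W fin finite_subset by blast
  have S: "\<omega> \<in> S_set V E W" using flat_in_S_set_support[OF fin flat] by (simp add: W_def)
  consider "num_components E W > 1" | "W = {}" | "num_components E W = 1"
    using num_components_eq_0_iff[OF finW, of E] by linarith
  then show ?thesis
  proof cases
    case 1
    then show ?thesis using W S by blast
  next
    case 2
    obtain v where v: "v \<in> V" using x(2) by blast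
    have "num_components E {v} = 1"
      using num_components_eq_1_iff[of "{v}" E] connected_in_refl[of v "{v}" E] by simp
    moreover have "\<omega> \<in> P_set V \<theta> {v}"
      using 2 tup zero_in_det_locus[OF rep] unfolding P_set_iff W_def
      by (auto intro!: bexI[of _ 0])
    ultimately show ?thesis using v by blast
  next
    case 3
    then obtain a where a: "a \<in> W" and conn: "\<And>u v. u \<in> W \<Longrightarrow> v \<in> W \<Longrightarrow> (u, v) \<in> connected_in E W"
      using num_components_eq_1_iff[OF finW] by blast
    have a0: "\<omega> a \<noteq> 0" using a by (simp add: W_def)
    have sl2: "\<omega> v \<in> sl2" for v using tuplesD[OF tup] .
    have "parallel (\<omega> a) (\<omega> v)" if "v \<in> W" for v
      using S conn[OF a that] unfolding S_set_iff[OF fin W] by blast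
    then obtain l where l: "\<And>v. v \<in> W \<Longrightarrow> \<omega> v = mat_scale (l v) (\<omega> a)"
      using parallel_family_scalars[OF a0, of W \<omega>] by blast
    show ?thesis
    proof (cases "det (\<theta> (\<omega> a)) = 0")
      case True
      then have "\<omega> a \<in> det_locus \<theta>" using sl2 by (simp add: det_locus_def)
      moreover have "\<omega> v = 0" if "v \<notin> W" for v using that by (simp add: W_def)
      ultimately have "\<omega> \<in> P_set V \<theta> W" using l tup unfolding P_set_iff by blast
      then show ?thesis using W 3 by blast
    next
      case False
      then have inj: "y = y'" if "\<theta> (\<omega> a) *v y = \<theta> (\<omega> a) *v y'" for y y'
        using that det_eq_0_iff_kernel[of "\<theta> (\<omega> a)"]
        by (metis eq_iff_diff_eq_0 matrix_vector_mult_diff_distrib)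
      have \<theta>l: "\<theta> (\<omega> v) *v y = l v *s (\<theta> (\<omega> a) *v y)" if "v \<in> W" for v y
        by (subst l[OF that]) (simp add: rep_scale[OF rep sl2] mat_scale_mult_vec)
      have l0: "l v \<noteq> 0" if "v \<in> W" for v using that l[OF that] by (auto simp: W_def)
      have la: "l a = 1"
      proof -
        have "mat_scale (l a - 1) (\<omega> a) = 0" using l[OF a] by (simp add: vec_eq_iff left_diff_distrib)
        then show ?thesis using a0 by (auto simp: vec_eq_iff)
      qed
      have on_W: "x v = l v *s x a" if "v \<in> W" for v
        using conn[OF a that]
      proof (induction rule: connected_in_induct)
        case base
        then show ?case by (simp add: la)
      next
        case (step u v)
        have "l u *s (\<theta> (\<omega> a) *v x v) = l u *s (\<theta> (\<omega> a) *v (l v *s x a))"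
          using x(1)[OF step(3)] step by (simp add: \<theta>l vector_scalar_commute mult.commute)
        then show ?case using l0[OF step(1)] inj by simp
      qed
      have "\<exists>v\<in>V - W. \<forall>u\<in>W. {u, v} \<notin> E"
      proof (rule ccontr)
        assume neg: "\<not> (\<exists>v\<in>V - W. \<forall>u\<in>W. {u, v} \<notin> E)"
        obtain y where y: "\<theta> (\<omega> a) *v y = x a" using det_nz_imp_surj[OF False] by blast
        have "x v = \<theta> (\<omega> v) *v y" if "v \<in> V" for v
        proof (cases "v \<in> W")
          case True
          then show ?thesis using \<theta>l[OF True] on_W[OF True] y by simp
        next
          case vW: False
          then obtain u where u: "u \<in> W" "{u, v} \<in> E" using neg \<open>v \<in> V\<close> by blast
          have \<omega>v: "\<omega> v = 0" using vW by (simp add: W_def)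
          then have "l u *s (\<theta> (\<omega> a) *v x v) = 0"
            using x(1)[OF u(2)] \<theta>l[OF u(1)] rep_zero[OF rep] by simp
          then have "\<theta> (\<omega> a) *v x v = 0" using l0[OF u(1)] by simp
          then have "x v = 0" using False det_eq_0_iff_kernel by blast
          then show ?thesis using \<omega>v rep_zero[OF rep] by simp
        qed
        then show False using x(2) by blast
      qed
      then obtain v where v: "v \<in> V" "v \<notin> W" "\<And>u. u \<in> W \<Longrightarrow> {u, v} \<notin> E" by blast
      let ?W' = "insert v W"
      have W': "?W' \<subseteq> V" using W v by blast
      have "(v, u) \<notin> connected_in E ?W'" if "u \<in> W" for u
      proof
        assume "(v, u) \<in> connected_in E ?W'"
        then have "u = v"
        proof (induction rule: connected_in_induct)
          case (step x y)
          then show ?case using v(3)[of y] by (auto simp: insert_commute)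
        qed simp
        then show False using that v(2) by simp
      qed
      then have "num_components E ?W' > 1"
        using a num_components_gt_1_iff[of ?W' E] finW by blast
      moreover have "\<omega> \<in> S_set V E ?W'"
        unfolding S_set_iff[OF fin W']
      proof (intro conjI)
        have "parallel (\<omega> u) (\<omega> w)" for u w
        proof (cases "u \<in> W \<and> w \<in> W")
          case True
          then show ?thesis using l[of u] l[of w] by (metis parallel_multiples)
        next
          case False
          then show ?thesis by (auto simp: W_def)
        qed
        then show "\<forall>(u, w)\<in>connected_in E ?W'. parallel (\<omega> u) (\<omega> w)" by blast
      qed (use tup in \<open>auto simp: W_def\<close>)
      ultimately show ?thesis using W' by blast
    qed
  qed
qed

lemma P_set_mono:
  assumes "W \<subseteq> W'" "W' \<subseteq> V" shows "P_set V \<theta> W \<subseteq> P_set V \<theta> W'"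
proof
  fix \<omega> assume \<omega>: "\<omega> \<in> P_set V \<theta> W"
  then obtain l g where g: "g \<in> det_locus \<theta>" "\<And>v. v \<in> W \<Longrightarrow> \<omega> v = mat_scale (l v) g"
    unfolding P_set_iff by blast
  have \<omega>': "\<omega> \<in> tuples V" "\<And>v. v \<notin> W \<Longrightarrow> \<omega> v = 0" using \<omega> unfolding P_set_iff by auto
  have "\<omega> v = mat_scale (if v \<in> W then l v else 0) g" for v using g(2) \<omega>'(2) by simp
  then have "\<exists>l. \<exists>g\<in>det_locus \<theta>. \<forall>v\<in>W'. \<omega> v = mat_scale (l v) g"
    by (intro exI[of _ "\<lambda>v. if v \<in> W then l v else 0"] bexI[OF _ g(1)]) blast
  moreover have "\<omega> v = 0" if "v \<notin> W'" for v using \<omega>'(2) assms(1) that by blast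
  ultimately show "\<omega> \<in> P_set V \<theta> W'" using \<omega>'(1) unfolding P_set_iff by blast
qed

lemma resonance_decomposition:
  assumes graph: "simplicial_graph V E" and rep: "sl2_representation \<theta>"
  shows "resonance V E \<theta> =
    (\<Union>W \<in> {W. num_components E W = 1 \<and> preceq_maximal V E W}. P_set V \<theta> W) \<union>
    (\<Union>W \<in> {W. num_components E W > 1 \<and> preceq_maximal V E W}. S_set V E W)" (is "_ = ?P \<union> ?S")
proof -
  have fin: "finite V" using graph by (simp add: simplicial_graph_def)
  have above_S: "\<omega> \<in> ?S" if W: "W \<subseteq> V" "num_components E W > 1" "\<omega> \<in> S_set V E W" for W \<omega>
  proof -
    obtain W' where W': "sub_preceq E W W'" "num_components E W' > 1" "preceq_maximal V E W'"
      using ex_maximal_above[OF fin W(1), of "\<lambda>W. num_components E W > 1"]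
        num_components_gt_1_mono fin finite_subset W(2) by metis
    then have "W' \<subseteq> V" by (simp add: preceq_maximal_def)
    then show ?thesis using S_set_mono[OF fin _ W'(1)] W(3) W'(2,3) by blast
  qed
  have above_P: "\<omega> \<in> ?P \<union> ?S" if W: "W \<subseteq> V" "num_components E W = 1" "\<omega> \<in> P_set V \<theta> W" for W \<omega>
  proof -
    obtain W' where W': "sub_preceq E W W'" "preceq_maximal V E W'"
      using ex_maximal_above[OF fin W(1), of "\<lambda>_. True"] by blast
    then have sub: "W \<subseteq> W'" "W' \<subseteq> V" by (auto simp: preceq_maximal_def sub_preceq_iff)
    have "W \<noteq> {}" using W num_components_eq_1_iff fin finite_subset by metis
    then have "num_components E W' \<noteq> 0"
      using num_components_eq_0_iff[of W' E] sub fin finite_subset by blast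
    then consider "num_components E W' = 1" | "num_components E W' > 1" by linarith
    then show ?thesis
    proof cases
      case 1
      then show ?thesis using P_set_mono[OF sub] W(3) W'(2) by blast
    next
      case 2
      have "\<omega> \<in> S_set V E W" using P_set_eq[OF fin W(1) rep W(2)] W(3) by blast
      then have "\<omega> \<in> S_set V E W'" using S_set_mono[OF fin sub(2) W'(1)] by blast
      then show ?thesis using 2 W'(2) by blast
    qed
  qed
  show ?thesis
  proof (intro subset_antisym)
    show "resonance V E \<theta> \<subseteq> ?P \<union> ?S"
    proof
      fix \<omega> assume "\<omega> \<in> resonance V E \<theta>"
      from resonant_cases[OF graph rep this] show "\<omega> \<in> ?P \<union> ?S"
      proof (elim disjE exE conjE)
        fix W assume "W \<subseteq> V" "num_components E W = 1" "\<omega> \<in> P_set V \<theta> W"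
        then show ?thesis by (rule above_P)
      next
        fix W assume "W \<subseteq> V" "num_components E W > 1" "\<omega> \<in> S_set V E W"
        then show ?thesis by (intro UnI2 above_S)
      qed
    qed
    have "P_set V \<theta> W \<subseteq> resonance V E \<theta>" if "num_components E W = 1" "preceq_maximal V E W" for W
      using that by (intro P_set_resonant[OF graph _ rep]) (auto simp: preceq_maximal_def)
    moreover have "S_set V E W \<subseteq> resonance V E \<theta>" if "num_components E W > 1" "preceq_maximal V E W" for W
      using that by (intro S_set_disconnected_resonant[OF graph _ rep]) (auto simp: preceq_maximal_def)
    ultimately show "?P \<union> ?S \<subseteq> resonance V E \<theta>" by blast
  qed
qed

lemma nilpotent_constant_in_P_set:
  assumes rep: "sl2_representation \<theta>" and "W \<subseteq> V"
  shows "(\<lambda>v. if v \<in> W then sl2_matrix 0 1 0 else 0) \<in> P_set V \<theta> W"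
proof -
  have "sl2_matrix 0 1 0 \<in> {g \<in> sl2. det g = 0}" by (simp add: det_sl2_matrix)
  moreover have "{g \<in> sl2. det g = 0} \<subseteq> det_locus \<theta>" using det_locus_dichotomy[OF rep] by blast
  ultimately have "sl2_matrix 0 1 0 \<in> det_locus \<theta>" by (rule rev_subsetD)
  moreover have "(\<lambda>v. if v \<in> W then sl2_matrix 0 1 0 else 0) \<in> tuples V"
    using assms(2) by (auto simp: tuples_def sl2_closed)
  moreover from calculation(1)
  have "\<exists>l. \<exists>g\<in>det_locus \<theta>. \<forall>v\<in>W. (if v \<in> W then sl2_matrix 0 1 0 else 0) = mat_scale (l v) g"
    by (intro exI[of _ "\<lambda>_. 1"] bexI[of _ "sl2_matrix 0 1 0"]) simp_all
  ultimately show ?thesis unfolding P_set_iff by simp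
qed

text \<open>The zero locus of \<open>det \<circ> \<theta>\<close> contains a nonzero nilpotent element, so \<open>P\<^sub>W\<close> contains a tuple with
  support \<open>W\<close>. As \<open>W\<close> is connected, \<open>W \<subseteq> W'\<close> already implies that \<open>W\<close> precedes \<open>W'\<close>. Used with \<open>X\<close>
  either \<open>P\<^sub>W'\<close> or \<open>S\<^sub>W'\<close>.\<close>

lemma P_set_incomparable:
  assumes fin: "finite V" and rep: "sl2_representation \<theta>"
    and W: "num_components E W = 1" "preceq_maximal V E W" "W' \<subseteq> V"
    and X: "P_set V \<theta> W \<subseteq> X" and support: "\<And>\<omega> v. \<omega> \<in> X \<Longrightarrow> v \<notin> W' \<Longrightarrow> \<omega> v = 0"
  shows "W' = W"
proof -
  have WV: "W \<subseteq> V" using W(2) by (simp add: preceq_maximal_def)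
  have nz: "sl2_matrix 0 1 0 \<noteq> 0" by (simp add: sl2_matrix_ops sl2_matrix_eq_iff)
  have "W \<subseteq> W'"
  proof
    fix v assume "v \<in> W"
    then show "v \<in> W'"
      using support[OF subsetD[OF X nilpotent_constant_in_P_set[OF rep WV]], of v] nz by auto
  qed
  moreover have "\<And>u v. u \<in> W \<Longrightarrow> v \<in> W \<Longrightarrow> (u, v) \<in> connected_in E W"
    using W(1) num_components_eq_1_iff finite_subset[OF WV fin] by metis
  ultimately have "sub_preceq E W W'" by (simp add: sub_preceq_iff)
  then show ?thesis using W(2,3) by (simp add: preceq_maximal_def)
qed

lemma S_set_subset_P_set_imp_connected:
  assumes fin: "finite V" and "W \<subseteq> V" "W' \<subseteq> V" and rep: "sl2_representation \<theta>"
    and c: "num_components E W' = 1" and sub: "S_set V E W \<subseteq> P_set V \<theta> W'"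
  shows "\<not> num_components E W > 1"
proof
  assume "num_components E W > 1"
  moreover have "S_set V E W \<subseteq> S_set V E W'" using sub P_set_eq[OF fin assms(3) rep c] by blast
  then have "sub_preceq E W W'" by (rule S_set_subset_imp_sub_preceq[OF fin assms(2,3)])
  ultimately have "num_components E W' > 1"
    using num_components_gt_1_mono finite_subset[OF assms(3) fin] by metis
  then show False using c by simp
qed

theorem corollary6p5:
  fixes V :: "'v set" and E :: "'v set set" and \<theta> :: "complex^2^2 \<Rightarrow> complex^'n^'n"
  assumes "simplicial_graph V E" and "sl2_representation \<theta>"
  shows "flat_connections V E = (\<Union>W \<in> {W. preceq_maximal V E W}. S_set V E W)
    \<and> bij_betw (S_set V E) {W. preceq_maximal V E W}
        (irreducible_components V (flat_connections V E))
    \<and> resonance V E \<theta> =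
        (\<Union>W \<in> {W. num_components E W = 1 \<and> preceq_maximal V E W}. P_set V \<theta> W) \<union>
        (\<Union>W \<in> {W. W \<subseteq> V \<and> num_components E W > 1 \<and>
            (\<nexists>W'. W' \<subseteq> V \<and> W' \<noteq> W \<and> sub_preceq E W W' \<and> num_components E W' > 1)}. S_set V E W)
    \<and> bij_betw (case_sum (P_set V \<theta>) (S_set V E))
        ({W. num_components E W = 1 \<and> preceq_maximal V E W} <+>
         {W. W \<subseteq> V \<and> num_components E W > 1 \<and>
            (\<nexists>W'. W' \<subseteq> V \<and> W' \<noteq> W \<and> sub_preceq E W W' \<and> num_components E W' > 1)})
        (irreducible_components V (resonance V E \<theta>))"
proof -
  have fin: "finite V" using assms(1) by (simp add: simplicial_graph_def)
  let ?M = "{W. preceq_maximal V E W}"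
  let ?M1 = "{W. num_components E W = 1 \<and> preceq_maximal V E W}"
  let ?M2 = "{W. num_components E W > 1 \<and> preceq_maximal V E W}"
  have M2: "{W. W \<subseteq> V \<and> num_components E W > 1 \<and>
      (\<nexists>W'. W' \<subseteq> V \<and> W' \<noteq> W \<and> sub_preceq E W W' \<and> num_components E W' > 1)} = ?M2"
  proof (rule Collect_cong)
    fix W
    show "W \<subseteq> V \<and> num_components E W > 1 \<and>
      (\<nexists>W'. W' \<subseteq> V \<and> W' \<noteq> W \<and> sub_preceq E W W' \<and> num_components E W' > 1) \<longleftrightarrow>
      num_components E W > 1 \<and> preceq_maximal V E W"
    proof (cases "W \<subseteq> V \<and> num_components E W > 1")
      case True
      then show ?thesis using maximal_disconnected_iff[OF fin] by simp
    next
      case False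
      then show ?thesis by (auto simp: preceq_maximal_def)
    qed
  qed
  have sub: "W \<subseteq> V" if "preceq_maximal V E W" for W using that by (simp add: preceq_maximal_def)
  have finM: "finite ?M" by (rule finite_subset[of _ "Pow V"]) (use sub fin in auto)
  then have finM12: "finite ?M1" "finite ?M2" by (auto intro: rev_finite_subset)
  have S_inj: "W = W'" if "preceq_maximal V E W" "preceq_maximal V E W'" "S_set V E W \<subseteq> S_set V E W'" for W W'
    using S_set_subset_imp_sub_preceq[OF fin sub sub] that unfolding preceq_maximal_def by metis
  have F: "flat_connections V E = (\<Union>W\<in>?M. S_set V E W)" by (rule flat_connections_decomposition[OF fin])
  have F_components: "bij_betw (S_set V E) ?M (irreducible_components V (flat_connections V E))"
    by (rule irreducible_components_finite_union[OF finM _ _ _ F])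
       (use S_set_closed[OF fin] S_set_irreducible[OF fin] sub S_inj in auto)
  have R: "resonance V E \<theta> = (\<Union>W\<in>?M1. P_set V \<theta> W) \<union> (\<Union>W\<in>?M2. S_set V E W)"
    by (rule resonance_decomposition[OF assms])
  let ?Z = "case_sum (P_set V \<theta>) (S_set V E)"
  have R_components: "bij_betw ?Z (?M1 <+> ?M2) (irreducible_components V (resonance V E \<theta>))"
  proof (rule irreducible_components_finite_union)
    show "finite (?M1 <+> ?M2)" using finM12 by simp
    have "zariski_closed V (?Z i) \<and> zariski_irreducible V (?Z i)" if "i \<in> ?M1 <+> ?M2" for i
      using that
    proof (elim PlusE)
      fix W assume "W \<in> ?M1" "i = Inl W"
      then show ?thesis
        using sub P_set_closed[OF fin _ assms(2), of W E] P_set_irreducible[OF assms(2), of W V] by simp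
    next
      fix W assume "W \<in> ?M2" "i = Inr W"
      then show ?thesis using sub S_set_closed[OF fin] S_set_irreducible[OF fin] by simp
    qed
    then show "zariski_closed V (?Z i)" "zariski_irreducible V (?Z i)" if "i \<in> ?M1 <+> ?M2" for i
      using that by blast+
    show "resonance V E \<theta> = (\<Union>i\<in>?M1 <+> ?M2. ?Z i)" unfolding R by auto
    fix i j assume ij: "i \<in> ?M1 <+> ?M2" "j \<in> ?M1 <+> ?M2" "?Z i \<subseteq> ?Z j"
    from ij(1) show "i = j"
    proof (elim PlusE)
      fix W assume W: "W \<in> ?M1" "i = Inl W"
      then have c: "num_components E W = 1" "preceq_maximal V E W" by auto
      from ij(2) show ?thesis
      proof (elim PlusE)
        fix W' assume W': "W' \<in> ?M1" "j = Inl W'"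
        have "W' \<subseteq> V" "P_set V \<theta> W \<subseteq> P_set V \<theta> W'" using W W' ij(3) sub by simp_all
        then have "W' = W"
          by (rule P_set_incomparable[OF fin assms(2) c]) (simp add: P_set_iff)
        then show ?thesis using W W' by simp
      next
        fix W' assume W': "W' \<in> ?M2" "j = Inr W'"
        then have W'V: "W' \<subseteq> V" and "P_set V \<theta> W \<subseteq> S_set V E W'" using W ij(3) sub by simp_all
        then have "W' = W"
          by (rule P_set_incomparable[OF fin assms(2) c]) (simp add: S_set_iff[OF fin W'V])
        then show ?thesis using c(1) W' by simp
      qed
    next
      fix W assume W: "W \<in> ?M2" "i = Inr W"
      from ij(2) show ?thesis
      proof (elim PlusE)
        fix W' assume W': "W' \<in> ?M1" "j = Inl W'"
        then have "\<not> num_components E W > 1"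
          using S_set_subset_P_set_imp_connected[OF fin sub sub assms(2), of W W' E] W ij(3) by auto
        then show ?thesis using W by simp
      next
        fix W' assume "W' \<in> ?M2" "j = Inr W'"
        then show ?thesis using S_inj W ij(3) by simp
      qed
    qed
  qed
  show ?thesis unfolding M2 using F F_components R R_components by blast
qed

end
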